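(* Let $m, L \in \mathbb{N}$, $1 \le p < q < \infty$, and put $R := \lceil q/\min\{2,p\}\rceil$. Let $A_{L,R}$ be the multi-sensitivity algorithm described in the context (built from either of the two versions of the routine $\mathrm{Discover}$). Then for every $\mathbf{x} \in \mathbb{R}^m$ with $\|\mathbf{x}\|_p \le 1$, $$\left(\mathbb{E}\,\|\mathbf{x} - A_{L,R}(\mathbf{x})\|_q^q\right)^{1/q} \le 3^{1/q}\cdot \begin{cases} 2^{-\left(\frac1p-\frac1q\right)L} & \text{for } 1\le p\le 2,\\ 2^{-\frac12\left(1-\frac pq\right)L} & \text{for } p>2.\end{cases}$$ Moreover, there is a constant $C>0$ depending only on $p$ and $q$ such that, whenever $m^{\min\{1,\,2/p\}} \ge 16\cdot 2^L$, the information cost satisfies $$\operatorname{card} A_{L,R} \le C\cdot \begin{cases} 2^L\cdot \log\log\frac{m}{2^L} & \text{for } 1\le p\le 2,\\ m^{1-2/p}\cdot 2^L\cdot\log\log\frac{m^{2/p}}{2^L} & \text{for } p>2.\end{cases}$$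
   Context: Notation: $[m]=\{1,\dots,m\}$; $\log$ is the natural logarithm; for $J\subseteq[m]$, $\mathbf{x}_J=(x_j)_{j\in J}$; $\|\cdot\|_p$ is the usual $\ell_p$-norm. Randomized algorithms. A randomized algorithm (or routine) accesses $\mathbf{x}\in\mathbb{R}^m$ only through finitely many values $y_i=L_i(\mathbf{x})$ of linear functionals $L_i:\mathbb{R}^m\to\mathbb{R}$; each $L_i$, and the decision to stop, may depend on a random element $\omega$ of a probability space and on previously observed values $y_1,\dots,y_{i-1}$ (adaptivity); the output is a function of $\omega$ and the observed values. If $k(\omega,\mathbf{x})$ is the number of functionals evaluated, the information cost (cardinality) of $A$ is $\operatorname{card}A=\sup_{\omega,\mathbf{x}}k(\omega,\mathbf{x})$. Equi-hashing. For $D\in\mathbb{N}$ and a uniformly random permutation $\pi$ of $[m]$, the vector $\mathbf{H}=(\lceil \pi(i)D/m\rceil)_{i=1}^m\in[D]^m$ has distribution $\mathrm{EquiHash}(m,D)$. It defines buckets $J_d=\{i\in[m]:H_i=d\}$, $d\in[D]$. Spot. For $\delta\in(0,1)$ and an integer $\kappa\ge0$, $\mathrm{Spot}_{\delta,\kappa}(\mathbf{x},J)$ denotes a fixed adaptive randomized routine (known from earlier work) which for $J\subseteq[m]$ uses at most $2(\kappa+1)$ linear measurements of $\mathbf{x}$, returns a subset of $J$ with at most one element, and has the following property: if $\#J\le 2^{4(9/8)^{\kappa}}$ and $j\in J$ satisfies $x_j\ne0$ and $\|\mathbf{x}_{J\setminus\{j\}}\|_2\le \frac{\delta\,|x_j|}{129\sqrt{2\log(16/\delta)}}$,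 then $\mathbb{P}(\mathrm{Spot}_{\delta,\kappa}(\mathbf{x},J)=\{j\})\ge1-\delta$. Iteration depth. $k^\ast(m/D):=\max\left\{0,\left\lceil\log_{9/8}\frac{\log_2\lceil m/D\rceil}{4}\right\rceil\right\}$ (equal to $0$ if $\lceil m/D\rceil=1$). Precond. For $J\subseteq[m]$ and $k\in\mathbb{N}$ let $A=(a_{ij})_{i\in[k],j\in J}$ have i.i.d. entries uniform on $\{\pm1\}$, columns $\mathbf{a}_j$, and let $\mathbf{s}=\operatorname{sgn}(A\mathbf{x}_J)\in\{\pm1\}^k$ entrywise with $\operatorname{sgn}(0)=1$. With $d_H(\mathbf{a},\mathbf{b})=\frac12\|\mathbf{a}-\mathbf{b}\|_1$, put $\mathrm{Precond}_k(\mathbf{x},J)=\{j\in J: d_H(\mathbf{a}_j,\mathbf{s})\le k/6\text{ or }d_H(\mathbf{a}_j,-\mathbf{s})\le k/6\}$ (this uses $k$ measurements). Discover. Given $D\in\mathbb{N}$, draw $\mathbf{H}\sim\mathrm{EquiHash}(m,D)$ with buckets $J_1,\dots,J_D$, and let $k^\ast=k^\ast(m/D)$. Two versions (all random components independent): basic version $\mathrm{Discover}^0_D(\mathbf{x})=\bigcup_{d=1}^D\mathrm{Spot}_{1/3,k^\ast}(\mathbf{x},J_d)$; version with preconditioning $\mathrm{Discover}^+_D(\mathbf{x})=\bigcup_{d=1}^D\mathrm{Spot}_{1/4,k^\ast}(\mathbf{x},\mathrm{Precond}_{551}(\mathbf{x},J_d))$. The algorithm $A_{L,R}$. Fix one version,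 written $\mathrm{Discover}$. Let $C_p=4(387\sqrt{2\log48})^p$ for the basic version and $C_p=6\cdot5^{p/2}$ for the version with preconditioning. For $l\in\mathbb{N}$ let $D^{(l)}=\lceil C_p2^l\rceil$ if $1\le p\le2$ and $D^{(l)}=\lceil C_2\,m^{1-2/p}\,2^l\rceil$ if $p>2$. Let $K_{L,R}=\bigcup_{l=1}^L\bigcup_{r=1}^R\mathrm{Discover}^{(r,l)}_{D^{(l)}}(\mathbf{x})$, where the superscripts $(r,l)$ denote independent executions. The output $A_{L,R}(\mathbf{x})=\mathbf{z}\in\mathbb{R}^m$ is given by $z_j=x_j$ for $j\in K_{L,R}$ (measured directly, at a cost of one functional per element of $K_{L,R}$) and $z_j=0$ otherwise. *)

theory Defs
  imports "HOL-Probability.Probability" "HOL-Combinatorics.Permutations"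
begin

text \<open>
  A vector of \<open>\<real>\<^sup>m\<close> is a function \<open>nat \<Rightarrow> real\<close> of which only the coordinates in \<open>{1..m}\<close> are used.
\<close>

definition lp_norm :: "real \<Rightarrow> nat set \<Rightarrow> (nat \<Rightarrow> real) \<Rightarrow> real" where
  "lp_norm p J x = (\<Sum>j\<in>J. \<bar>x j\<bar> powr p) powr (1 / p)"


section \<open>Adaptive algorithms using linear measurements\<close>

text \<open>
  For a fixed random element, an adaptive algorithm is a decision tree. A node \<open>Query c f\<close>
  evaluates the linear functional with coefficient vector \<open>c\<close> and continues with \<open>f y\<close>, where
  \<open>y\<close> is the observed value. A randomized algorithm is a function from a probability space to
  such trees.
\<close>

datatype 'a meas_alg = Output 'a | Query "nat \<Rightarrow> real" "real \<Rightarrow> 'a meas_alg"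

primrec run :: "nat \<Rightarrow> 'a meas_alg \<Rightarrow> (nat \<Rightarrow> real) \<Rightarrow> 'a" where
  "run m (Output a) x = a"
| "run m (Query c f) x = run m (f (\<Sum>i=1..m. c i * x i)) x"

primrec num_queries :: "nat \<Rightarrow> 'a meas_alg \<Rightarrow> (nat \<Rightarrow> real) \<Rightarrow> nat" where
  "num_queries m (Output a) x = 0"
| "num_queries m (Query c f) x = Suc (num_queries m (f (\<Sum>i=1..m. c i * x i)) x)"

definition info_cost :: "nat \<Rightarrow> 'w measure \<Rightarrow> ('w \<Rightarrow> 'a meas_alg) \<Rightarrow> enat" where
  "info_cost m \<Omega> A = (SUP \<omega>\<in>space \<Omega>. SUP x. enat (num_queries m (A \<omega>) x))"

primrec then_alg :: "'a meas_alg \<Rightarrow> ('a \<Rightarrow> 'b meas_alg) \<Rightarrow> 'b meas_alg" where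
  "then_alg (Output a) g = g a"
| "then_alg (Query c f) g = Query c (\<lambda>y. then_alg (f y) g)"

primrec union_alg :: "'i list \<Rightarrow> ('i \<Rightarrow> 'b set meas_alg) \<Rightarrow> 'b set meas_alg" where
  "union_alg [] f = Output {}"
| "union_alg (i # is) f =
     then_alg (f i) (\<lambda>A. then_alg (union_alg is f) (\<lambda>B. Output (A \<union> B)))"

text \<open>One query with coefficients \<open>c i\<close> for each listed \<open>i\<close>; at all other indices the returned
  function is \<open>0\<close>.\<close>

primrec query_all :: "'i list \<Rightarrow> ('i \<Rightarrow> nat \<Rightarrow> real) \<Rightarrow> ('i \<Rightarrow> real) meas_alg" where
  "query_all [] c = Output (\<lambda>_. 0)"
| "query_all (i # is) c =
     Query (c i) (\<lambda>y. then_alg (query_all is c) (\<lambda>f. Output (f(i := y))))"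


section \<open>Hashing and preconditioning\<close>

definition perm_space :: "nat \<Rightarrow> (nat \<Rightarrow> nat) measure" where
  "perm_space m = uniform_count_measure {\<pi>. \<pi> permutes {1..m}}"

definition equi_hash :: "nat \<Rightarrow> nat \<Rightarrow> (nat \<Rightarrow> nat) \<Rightarrow> nat \<Rightarrow> nat" where
  "equi_hash m D \<pi> i = nat \<lceil>real (\<pi> i) * real D / real m\<rceil>"

definition bucket :: "nat \<Rightarrow> nat \<Rightarrow> (nat \<Rightarrow> nat) \<Rightarrow> nat \<Rightarrow> nat set" where
  "bucket m D \<pi> d = {i \<in> {1..m}. equi_hash m D \<pi> i = d}"

text \<open>The sign matrices have a column for every element of \<open>{1..m}\<close>; \<open>precond\<close> on \<open>J\<close> reads only
  the columns in \<open>J\<close>.\<close>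

definition sign_space :: "nat \<Rightarrow> nat \<Rightarrow> (nat \<times> nat \<Rightarrow> real) measure" where
  "sign_space k m = PiM ({1..k} \<times> {1..m}) (\<lambda>_. uniform_count_measure {-1, 1})"

definition sgn1 :: "real \<Rightarrow> real" where
  "sgn1 y = (if y \<ge> 0 then 1 else -1)"

definition hamming :: "nat \<Rightarrow> (nat \<Rightarrow> real) \<Rightarrow> (nat \<Rightarrow> real) \<Rightarrow> real" where
  "hamming k a b = (1/2) * (\<Sum>i=1..k. \<bar>a i - b i\<bar>)"

definition precond :: "nat \<Rightarrow> nat set \<Rightarrow> (nat \<times> nat \<Rightarrow> real) \<Rightarrow> nat set meas_alg" where
  "precond k J a =
     then_alg (query_all [1..<Suc k] (\<lambda>i j. if j \<in> J then a (i, j) else 0))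
       (\<lambda>y. Output {j \<in> J. hamming k (\<lambda>i. a (i, j)) (\<lambda>i. sgn1 (y i)) \<le> real k / 6
                         \<or> hamming k (\<lambda>i. a (i, j)) (\<lambda>i. - sgn1 (y i)) \<le> real k / 6})"


section \<open>The routine Spot\<close>

text \<open>Measurability is what makes the probability in the last clause meaningful.\<close>

definition is_spot ::
  "nat \<Rightarrow> real \<Rightarrow> nat \<Rightarrow> 'w measure \<Rightarrow> (nat set \<Rightarrow> 'w \<Rightarrow> nat set meas_alg) \<Rightarrow> bool" where
  "is_spot m \<delta> \<kappa> S spot \<longleftrightarrow>
     prob_space S \<and>
     (\<forall>J \<subseteq> {1..m}. \<forall>x.
        (\<lambda>\<omega>. run m (spot J \<omega>) x) \<in> measurable S (count_space UNIV) \<and>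
        (\<forall>\<omega>\<in>space S. num_queries m (spot J \<omega>) x \<le> 2 * (\<kappa> + 1) \<and>
                    run m (spot J \<omega>) x \<subseteq> J \<and> card (run m (spot J \<omega>) x) \<le> 1) \<and>
        (\<forall>j\<in>J. real (card J) \<le> 2 powr (4 * (9/8) ^ \<kappa>) \<and> x j \<noteq> 0 \<and>
               lp_norm 2 (J - {j}) x \<le> \<delta> * \<bar>x j\<bar> / (129 * sqrt (2 * ln (16 / \<delta>)))
               \<longrightarrow> measure S {\<omega> \<in> space S. run m (spot J \<omega>) x = {j}} \<ge> 1 - \<delta>))"

definition is_spot_family ::
  "nat \<Rightarrow> (real \<Rightarrow> nat \<Rightarrow> 'w measure) \<Rightarrow> (real \<Rightarrow> nat \<Rightarrow> nat set \<Rightarrow> 'w \<Rightarrow> nat set meas_alg) \<Rightarrow> bool"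
where
  "is_spot_family m S spot \<longleftrightarrow> (\<forall>\<delta> \<kappa>. 0 < \<delta> \<and> \<delta> < 1 \<longrightarrow> is_spot m \<delta> \<kappa> (S \<delta> \<kappa>) (spot \<delta> \<kappa>))"

definition k_star :: "nat \<Rightarrow> nat \<Rightarrow> nat" where
  "k_star m D =
     (if \<lceil>real m / real D\<rceil> = 1 then 0
      else nat (max 0 \<lceil>log (9/8) (log 2 (of_int \<lceil>real m / real D\<rceil>) / 4)\<rceil>))"


section \<open>The routine Discover\<close>

datatype version = Basic | Preconditioned

primrec spot_delta :: "version \<Rightarrow> real" where
  "spot_delta Basic = 1/3"
| "spot_delta Preconditioned = 1/4"

text \<open>The random input of one execution consists of a permutation and, for each bucket, a sign
  matrix (ignored by the basic version) and a random element for Spot.\<close>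

type_synonym 'w discover_input = "(nat \<Rightarrow> nat) \<times> (nat \<Rightarrow> (nat \<times> nat \<Rightarrow> real) \<times> 'w)"

definition discover_space ::
  "nat \<Rightarrow> version \<Rightarrow> (real \<Rightarrow> nat \<Rightarrow> 'w measure) \<Rightarrow> nat \<Rightarrow> 'w discover_input measure" where
  "discover_space m v S D =
     perm_space m \<Otimes>\<^sub>M
     PiM {1..D} (\<lambda>_. sign_space 551 m \<Otimes>\<^sub>M S (spot_delta v) (k_star m D))"

primrec bucket_alg ::
  "version \<Rightarrow> (nat set \<Rightarrow> 'w \<Rightarrow> nat set meas_alg) \<Rightarrow> nat set \<Rightarrow> (nat \<times> nat \<Rightarrow> real) \<times> 'w
     \<Rightarrow> nat set meas_alg" where
  "bucket_alg Basic spt J \<rho> = spt J (snd \<rho>)"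
| "bucket_alg Preconditioned spt J \<rho> = then_alg (precond 551 J (fst \<rho>)) (\<lambda>J'. spt J' (snd \<rho>))"

definition discover ::
  "nat \<Rightarrow> version \<Rightarrow> (real \<Rightarrow> nat \<Rightarrow> nat set \<Rightarrow> 'w \<Rightarrow> nat set meas_alg) \<Rightarrow> nat
     \<Rightarrow> 'w discover_input \<Rightarrow> nat set meas_alg" where
  "discover m v spot D \<omega> =
     union_alg [1..<Suc D]
       (\<lambda>d. bucket_alg v (spot (spot_delta v) (k_star m D)) (bucket m D (fst \<omega>) d) (snd \<omega> d))"


section \<open>The multi-sensitivity algorithm\<close>

primrec C_const :: "version \<Rightarrow> real \<Rightarrow> real" where
  "C_const Basic p = 4 * (387 * sqrt (2 * ln 48)) powr p"
| "C_const Preconditioned p = 6 * 5 powr (p / 2)"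

definition num_buckets :: "nat \<Rightarrow> real \<Rightarrow> version \<Rightarrow> nat \<Rightarrow> nat" where
  "num_buckets m p v l =
     (if p \<le> 2 then nat \<lceil>C_const v p * 2 ^ l\<rceil>
      else nat \<lceil>C_const v 2 * real m powr (1 - 2 / p) * 2 ^ l\<rceil>)"

definition multi_space ::
  "nat \<Rightarrow> real \<Rightarrow> version \<Rightarrow> (real \<Rightarrow> nat \<Rightarrow> 'w measure) \<Rightarrow> nat \<Rightarrow> nat
     \<Rightarrow> (nat \<times> nat \<Rightarrow> 'w discover_input) measure" where
  "multi_space m p v S L R =
     PiM ({1..R} \<times> {1..L}) (\<lambda>(r, l). discover_space m v S (num_buckets m p v l))"

definition multi_alg ::
  "nat \<Rightarrow> real \<Rightarrow> version \<Rightarrow> (real \<Rightarrow> nat \<Rightarrow> nat set \<Rightarrow> 'w \<Rightarrow> nat set meas_alg) \<Rightarrow> nat \<Rightarrow> nat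
     \<Rightarrow> (nat \<times> nat \<Rightarrow> 'w discover_input) \<Rightarrow> (nat \<Rightarrow> real) meas_alg" where
  "multi_alg m p v spot L R \<omega> =
     then_alg
       (union_alg (List.product [1..<Suc R] [1..<Suc L])
          (\<lambda>(r, l). discover m v spot (num_buckets m p v l) (\<omega> (r, l))))
       (\<lambda>K. query_all (sorted_list_of_set K) (\<lambda>j i. if i = j then 1 else 0))"

end

theory Submission
  imports Defs
begin

text \<open>
  Write \<open>t = min 2 p\<close>. The sum of the \<open>\<bar>x i\<bar> powr t\<close> is at most \<open>W = m powr (1 - t / p)\<close> by
  Young's inequality (\<open>sum_powr_embedding\<close>), and level \<open>l\<close> hashes into about \<open>C W 2 ^ l\<close> buckets.
  Two given indices collide with probability at most one over the number of buckets
  (\<open>prob_collision_le\<close>), so the bucket of \<open>j\<close> carries a foreign mass of expectation at most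
  \<open>1 / (C 2 ^ l)\<close>. When \<open>\<bar>x j\<bar> powr t \<ge> 1 / 2 ^ l\<close>, Markov's inequality makes this mass small compared
  with \<open>\<bar>x j\<bar> powr t\<close>, hence also the Euclidean norm of the rest of the bucket small compared with
  \<open>\<bar>x j\<bar>\<close>, and Spot returns \<open>j\<close>. The constants are such that one execution of level \<open>l\<close> finds \<open>j\<close>
  with probability at least 1/2 (\<open>discover_detects\<close>, \<open>level_detects\<close>).

  With preconditioning the rest of the bucket need only be smaller than \<open>\<bar>x j\<bar>\<close> by the factor
  \<open>sqrt 5\<close>. By Hoeffding's inequality the sign of a row of the random sign matrix then reveals the
  entry in column \<open>j\<close>, up to a global sign, with error at most 1/10. So \<open>j\<close> survives the test of
  distance \<open>k / 6\<close>, whereas another index can survive only if its independent random column agrees with that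
  of \<open>j\<close>, up to sign, in two thirds of the rows. For \<open>k = 551\<close> this is so rare that the survivors
  meet the demand of Spot (\<open>prob_precond_isolates\<close>).

  For the error, the weight \<open>w = \<bar>x j\<bar> powr t\<close> and the probability that no level finds \<open>j\<close>
  compensate: if \<open>w\<close> is about \<open>1 / 2 ^ l\<close>, then the levels from \<open>l\<close> to \<open>L\<close> halve the probability of
  a miss once each, so that \<open>w\<close> times the miss probability of one execution per level is at most
  \<open>1 / 2 ^ L\<close>, whatever \<open>l\<close> is (\<open>weight_times_miss_le\<close>). The exponent \<open>(q - p) / t\<close> turns
  \<open>\<bar>x j\<bar> powr t\<close> into \<open>\<bar>x j\<bar> powr (q - p)\<close>, and \<open>R\<close> repetitions raise the miss probability to a power at
  least as large. Summing over \<open>j\<close> with the remaining factors \<open>\<bar>x j\<bar> powr p\<close>, whose sum is at most 1,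
  bounds the expected error (\<open>multi_alg_error\<close>).

  For the cost, each bucket of level \<open>l\<close> costs a constant plus a multiple of the iteration depth. With
  \<open>U = m powr (t / p) / 2 ^ L\<close>, the bucket size on level \<open>l\<close> is at most \<open>U * 2 ^ (L - l)\<close>, so this
  depth is of order \<open>ln (ln U) + (L - l)\<close> (\<open>k_star_le\<close>). The linear growth in \<open>L - l\<close> is absorbed by
  the geometric growth of the number of buckets, and the last level dominates (\<open>multi_alg_cost\<close>).
\<close>

section \<open>Semantics of the combined algorithms\<close>

lemma run_then_alg [simp]: "run m (then_alg A g) x = run m (g (run m A x)) x"
  by (induction A) auto

lemma num_queries_then_alg [simp]:
  "num_queries m (then_alg A g) x = num_queries m A x + num_queries m (g (run m A x)) x"
  by (induction A) auto

lemma run_union_alg [simp]: "run m (union_alg xs f) x = (\<Union>i\<in>set xs. run m (f i) x)"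
  by (induction xs) auto

lemma num_queries_union_alg [simp]:
  "num_queries m (union_alg xs f) x = (\<Sum>i\<leftarrow>xs. num_queries m (f i) x)"
  by (induction xs) auto

lemma run_query_all:
  "run m (query_all xs c) x = (\<lambda>i. if i \<in> set xs then \<Sum>j=1..m. c i j * x j else 0)"
  by (induction xs) (auto simp: fun_eq_iff)

lemma num_queries_query_all [simp]: "num_queries m (query_all xs c) x = length xs"
  by (induction xs) auto

definition observed_sign :: "nat set \<Rightarrow> (nat \<Rightarrow> real) \<Rightarrow> (nat \<times> nat \<Rightarrow> real) \<Rightarrow> nat \<Rightarrow> real" where
  "observed_sign J x a r = sgn1 (\<Sum>i\<in>J. a (r, i) * x i)"

lemma hamming_cong:
  "(\<And>r. r \<in> {1..k} \<Longrightarrow> a r = a' r) \<Longrightarrow> (\<And>r. r \<in> {1..k} \<Longrightarrow> b r = b' r)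
    \<Longrightarrow> hamming k a b = hamming k a' b'"
  by (simp add: hamming_def)

text \<open>
  On \<open>J\<close> the functionals of the algorithm vanish outside \<open>J\<close>, so that the observed signs are those of
  the matrix restricted to the columns in \<open>J\<close>.
\<close>

lemma run_precond:
  assumes "J \<subseteq> {1..m}"
  shows "run m (precond k J a) x =
    {j \<in> J. hamming k (\<lambda>r. a (r, j)) (observed_sign J x a) \<le> real k / 6
         \<or> hamming k (\<lambda>r. a (r, j)) (\<lambda>r. - observed_sign J x a r) \<le> real k / 6}"
proof -
  have "(\<Sum>i=1..m. (if i \<in> J then a (r, i) else 0) * x i) = (\<Sum>i\<in>J. a (r, i) * x i)" for r
    using assms by (intro sum.mono_neutral_cong_right) auto
  then have *: "observed_sign J x a r = sgn1 (run m (query_all [1..<Suc k]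
      (\<lambda>i j. if j \<in> J then a (i, j) else 0)) x r)" if "r \<in> {1..k}" for r
    using that by (auto simp: run_query_all observed_sign_def)
  have "hamming k (\<lambda>r. a (r, j)) (observed_sign J x a) = hamming k (\<lambda>r. a (r, j))
      (\<lambda>r. sgn1 (run m (query_all [1..<Suc k] (\<lambda>i j. if j \<in> J then a (i, j) else 0)) x r))"
    and "hamming k (\<lambda>r. a (r, j)) (\<lambda>r. - observed_sign J x a r) = hamming k (\<lambda>r. a (r, j))
      (\<lambda>r. - sgn1 (run m (query_all [1..<Suc k] (\<lambda>i j. if j \<in> J then a (i, j) else 0)) x r))" for j
    by (rule hamming_cong; simp add: *)+
  then show ?thesis
    by (simp add: precond_def)
qed

lemma num_queries_precond [simp]: "num_queries m (precond k J a) x = k"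
  by (simp add: precond_def)

section \<open>Collisions under equi-hashing\<close>

lemma equi_hash_in_range:
  assumes "\<pi> permutes {1..m}" "i \<in> {1..m}" "D \<ge> 1"
  shows "equi_hash m D \<pi> i \<in> {1..D}"
proof -
  have p: "\<pi> i \<in> {1..m}" using assms permutes_in_image by metis
  have "0 < real (\<pi> i) * real D / real m"
    using p assms by auto
  moreover have "real (\<pi> i) * real D / real m \<le> real D"
    using p assms by (auto simp: field_simps)
  ultimately show ?thesis
    unfolding equi_hash_def by (auto simp: nat_le_iff ceiling_le_iff) linarith
qed

lemma card_nat_interval_le:
  assumes "0 \<le> a" "a \<le> b"
  shows "real (card {n::nat. a < real n \<and> real n \<le> b}) \<le> of_int \<lceil>b - a\<rceil>"
proof -
  have "{n::nat. a < real n \<and> real n \<le> b} = {nat \<lfloor>a\<rfloor><..nat \<lfloor>b\<rfloor>}"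
  proof -
    have "nat \<lfloor>a\<rfloor> < n \<longleftrightarrow> a < real n" for n
      using assms by (simp add: nat_less_iff floor_less_iff)
    moreover have "n \<le> nat \<lfloor>b\<rfloor> \<longleftrightarrow> real n \<le> b" for n
      using assms by (simp add: le_nat_iff le_floor_iff)
    ultimately show ?thesis by auto
  qed
  moreover have "nat \<lfloor>a\<rfloor> \<le> nat \<lfloor>b\<rfloor>"
    using assms by (intro nat_mono floor_mono)
  ultimately have "real (card {n::nat. a < real n \<and> real n \<le> b}) = of_int (\<lfloor>b\<rfloor> - \<lfloor>a\<rfloor>)"
    using assms by (simp add: of_nat_diff)
  also have "\<lfloor>b\<rfloor> - \<lfloor>a\<rfloor> \<le> \<lceil>b - a\<rceil>"
    by linarith
  finally show ?thesis by simp
qed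

text \<open>
  A permutation maps bucket \<open>d\<close> injectively into the integers of the half-open interval
  \<open>((d - 1) m / D, d m / D]\<close>, which has length \<open>m / D\<close>.
\<close>

lemma card_bucket_le:
  assumes "\<pi> permutes {1..m}" "m \<ge> 1" "D \<ge> 1"
  shows "real (card (bucket m D \<pi> d)) \<le> of_int \<lceil>real m / real D\<rceil>"
proof (cases "d = 0")
  case True
  then have "bucket m D \<pi> d = {}"
    using equi_hash_in_range[OF assms(1) _ assms(3)] by (force simp: bucket_def)
  moreover have "(0::real) \<le> of_int \<lceil>real m / real D\<rceil>"
    by (rule order.trans[OF _ le_of_int_ceiling]) simp
  ultimately show ?thesis by simp
next
  case False
  let ?N = "{n::nat. real (d - 1) * (real m / real D) < real n \<and> real n \<le> real d * (real m / real D)}"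
  have "\<pi> ` bucket m D \<pi> d \<subseteq> ?N"
  proof safe
    fix i assume "i \<in> bucket m D \<pi> d"
    then have "nat \<lceil>real (\<pi> i) * real D / real m\<rceil> = d"
      by (simp add: bucket_def equi_hash_def)
    with False have "\<lceil>real (\<pi> i) * real D / real m\<rceil> = int d"
      by (auto simp: nat_eq_iff split: if_splits)
    then have "real d - 1 < real (\<pi> i) * real D / real m" "real (\<pi> i) * real D / real m \<le> real d"
      by (simp_all add: ceiling_eq_iff)
    then have "real (d - 1) < real (\<pi> i) * real D / real m" "real (\<pi> i) * real D / real m \<le> real d"
      using False by (simp_all add: of_nat_diff)
    moreover have "0 < real m / real D" "real (\<pi> i) * real D / real m * (real m / real D) = real (\<pi> i)"
      using assms by simp_all
    ultimately show "real (d - 1) * (real m / real D) < real (\<pi> i)"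
      "real (\<pi> i) \<le> real d * (real m / real D)"
      using mult_strict_right_mono[of "real (d - 1)" "real (\<pi> i) * real D / real m" "real m / real D"]
        mult_right_mono[of "real (\<pi> i) * real D / real m" "real d" "real m / real D"] by simp_all
  qed
  moreover have "finite ?N"
    by (rule finite_subset[of _ "{..nat \<lfloor>real d * (real m / real D)\<rfloor>}"]) (auto intro: le_nat_floor)
  moreover have "inj_on \<pi> (bucket m D \<pi> d)"
    by (rule inj_on_subset[OF permutes_inj[OF assms(1)] subset_UNIV])
  ultimately have "card (bucket m D \<pi> d) \<le> card ?N"
    by (intro card_inj_on_le[of \<pi>])
  then have "real (card (bucket m D \<pi> d)) \<le> real (card ?N)" by simp
  also have "\<dots> \<le> of_int \<lceil>real d * (real m / real D) - real (d - 1) * (real m / real D)\<rceil>"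
    by (rule card_nat_interval_le) (simp_all add: divide_right_mono mult_right_mono)
  also have "real d * (real m / real D) - real (d - 1) * (real m / real D) = real m / real D"
  proof -
    have "real (d - 1) = real d - 1" using False by simp
    then show ?thesis by (simp only: left_diff_distrib)
  qed
  finally show ?thesis .
qed

lemma finite_perms: "finite {\<pi>. \<pi> permutes {1..m::nat}}"
  by (simp add: finite_permutations)

lemma perms_nonempty: "{\<pi>. \<pi> permutes {1..m::nat}} \<noteq> {}"
  using permutes_id by blast

lemma space_perm_space [simp]: "space (perm_space m) = {\<pi>. \<pi> permutes {1..m}}"
  by (simp add: perm_space_def space_uniform_count_measure sets_uniform_count_measure)

lemma sets_perm_space [simp]: "sets (perm_space m) = Pow {\<pi>. \<pi> permutes {1..m}}"
  by (simp add: perm_space_def space_uniform_count_measure sets_uniform_count_measure)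

lemma prob_space_perm_space: "prob_space (perm_space m)"
  unfolding perm_space_def
  by (intro prob_space_uniform_count_measure finite_perms perms_nonempty)

lemma measure_perm_space:
  "A \<subseteq> {\<pi>. \<pi> permutes {1..m}} \<Longrightarrow> measure (perm_space m) A = real (card A) / fact m"
  unfolding perm_space_def
  by (subst measure_uniform_count_measure) (simp_all add: finite_permutations card_permutations)

text \<open>
  Precomposition with the transposition of \<open>i\<close> and \<open>i'\<close> leaves the value at \<open>j\<close> alone and exchanges
  the two collision events.
\<close>

lemma card_collision_eq:
  assumes "i \<in> {1..m}" "i' \<in> {1..m}" "i \<noteq> j" "i' \<noteq> j"
  shows "card {\<pi>. \<pi> permutes {1..m} \<and> equi_hash m D \<pi> i = equi_hash m D \<pi> j} =
         card {\<pi>. \<pi> permutes {1..m} \<and> equi_hash m D \<pi> i' = equi_hash m D \<pi> j}"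
proof (rule bij_betw_same_card[of "\<lambda>\<pi>. \<pi> \<circ> Transposition.transpose i i'"], rule bij_betwI')
  have t: "Transposition.transpose i i' permutes {1..m}"
    using assms by (simp add: permutes_swap_id)
  show "(\<pi> \<circ> Transposition.transpose i i' = \<pi>' \<circ> Transposition.transpose i i') = (\<pi> = \<pi>')" for \<pi> \<pi>' :: "nat \<Rightarrow> nat"
    by (metis comp_assoc comp_id transpose_comp_involutory)
  show "\<pi> \<circ> Transposition.transpose i i' \<in> {\<pi>. \<pi> permutes {1..m} \<and> equi_hash m D \<pi> i' = equi_hash m D \<pi> j}"
    if "\<pi> \<in> {\<pi>. \<pi> permutes {1..m} \<and> equi_hash m D \<pi> i = equi_hash m D \<pi> j}" for \<pi>
    using that t assms by (auto simp: permutes_compose equi_hash_def)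
  show "\<exists>\<pi>' \<in> {\<pi>. \<pi> permutes {1..m} \<and> equi_hash m D \<pi> i = equi_hash m D \<pi> j}.
      \<pi> = \<pi>' \<circ> Transposition.transpose i i'"
    if "\<pi> \<in> {\<pi>. \<pi> permutes {1..m} \<and> equi_hash m D \<pi> i' = equi_hash m D \<pi> j}" for \<pi>
    using that t assms
    by (intro bexI[of _ "\<pi> \<circ> Transposition.transpose i i'"])
       (auto simp: permutes_compose equi_hash_def comp_assoc)
qed

text \<open>
  By symmetry all indices other than \<open>j\<close> collide with \<open>j\<close> equally often. For every single permutation
  the number of indices that do is one less than the size of a bucket, hence at most
  \<open>(m - 1) / D\<close>; averaging over the \<open>m - 1\<close> indices gives \<open>1 / D\<close>.
\<close>

lemma prob_collision_le:
  assumes "i \<in> {1..m}" "j \<in> {1..m}" "i \<noteq> j" "D \<ge> 1"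
  shows "measure (perm_space m)
    {\<pi>. \<pi> permutes {1..m} \<and> equi_hash m D \<pi> i = equi_hash m D \<pi> j} \<le> 1 / real D"
proof -
  let ?P = "{\<pi>. \<pi> permutes {1..m}}"
  let ?N = "\<lambda>i. {\<pi>. \<pi> permutes {1..m} \<and> equi_hash m D \<pi> i = equi_hash m D \<pi> j}"
  have m: "m \<ge> 2" using assms by auto
  have "real (m - 1) * real (card (?N i)) = (\<Sum>i'\<in>{1..m} - {j}. real (card (?N i)))"
    using assms by simp
  also have "\<dots> = (\<Sum>i'\<in>{1..m} - {j}. real (card (?N i')))"
    using assms by (intro sum.cong refl arg_cong[where f = real] card_collision_eq) auto
  also have "\<dots> = (\<Sum>i'\<in>{1..m} - {j}. \<Sum>\<pi>\<in>?P. of_bool (equi_hash m D \<pi> i' = equi_hash m D \<pi> j))"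
    using finite_perms by (simp add: Int_def)
  also have "\<dots> = (\<Sum>\<pi>\<in>?P. \<Sum>i'\<in>{1..m} - {j}. of_bool (equi_hash m D \<pi> i' = equi_hash m D \<pi> j))"
    by (rule sum.swap)
  also have "\<dots> \<le> (\<Sum>\<pi>\<in>?P. (real m - 1) / real D)"
  proof (rule sum_mono)
    fix \<pi> assume \<pi>: "\<pi> \<in> ?P"
    let ?B = "bucket m D \<pi> (equi_hash m D \<pi> j)"
    have "(\<Sum>i'\<in>{1..m} - {j}. of_bool (equi_hash m D \<pi> i' = equi_hash m D \<pi> j)) = real (card (?B - {j}))"
      by (simp add: bucket_def) (rule arg_cong[where f = card], auto)
    also have "\<dots> = real (card ?B) - 1"
    proof -
      have "finite ?B" "j \<in> ?B" using assms by (auto simp: bucket_def)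
      then show ?thesis by (metis card.remove of_nat_Suc add_diff_cancel_left')
    qed
    also have "\<dots> \<le> of_int \<lceil>real m / real D\<rceil> - 1"
      using card_bucket_le[of \<pi> m D] \<pi> m assms by simp
    \<comment> \<open>Rounding up costs at most \<open>(D - 1) / D\<close>, which is what turns \<open>m\<close> into \<open>m - 1\<close>.\<close>
    also have "\<lceil>real m / real D\<rceil> \<le> \<lfloor>(real m - 1) / real D\<rfloor> + 1"
    proof -
      let ?k = "\<lfloor>(real m - 1) / real D\<rfloor>"
      have "(real m - 1) / real D < of_int ?k + 1" by linarith
      then have "of_int (int m - 1) < (of_int ((?k + 1) * int D) :: real)"
        using assms by (simp add: field_simps)
      then have "int m - 1 < (?k + 1) * int D" by (simp only: of_int_less_iff)
      then have "int m \<le> (?k + 1) * int D" by simp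
      then have "(of_int (int m) :: real) \<le> of_int ((?k + 1) * int D)" by (simp only: of_int_le_iff)
      then show ?thesis
        using assms by (simp add: ceiling_le_iff field_simps)
    qed
    then have "of_int \<lceil>real m / real D\<rceil> - 1 \<le> (real m - 1) / real D" by linarith
    finally show "(\<Sum>i'\<in>{1..m} - {j}. of_bool (equi_hash m D \<pi> i' = equi_hash m D \<pi> j)) \<le> (real m - 1) / real D"
      by simp
  qed
  also have "\<dots> = real (m - 1) * (fact m / real D)"
    using m by (simp add: card_permutations of_nat_diff)
  finally have le: "real (m - 1) * real (card (?N i)) \<le> real (m - 1) * (fact m / real D)" .
  have "real (card (?N i)) \<le> fact m / real D"
    by (rule mult_left_le_imp_le[OF le]) (use m in simp)
  then show ?thesis
    by (subst measure_perm_space) (auto simp: field_simps)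
qed

lemma prob_bucket_sum_ge:
  assumes j: "j \<in> {1..m}" and D: "D \<ge> 1" and w: "\<And>i. 0 \<le> w i" and T: "0 < T"
  shows "measure (perm_space m)
      {\<pi>. \<pi> permutes {1..m} \<and> T \<le> (\<Sum>i\<in>bucket m D \<pi> (equi_hash m D \<pi> j) - {j}. w i)}
    \<le> (\<Sum>i=1..m. w i) / (real D * T)"
proof -
  interpret prob_space "perm_space m" by (rule prob_space_perm_space)
  let ?N = "\<lambda>i. {\<pi>. \<pi> permutes {1..m} \<and> equi_hash m D \<pi> i = equi_hash m D \<pi> j}"
  let ?f = "\<lambda>\<pi>. \<Sum>i\<in>{1..m} - {j}. w i * indicator (?N i) \<pi>"
  have N: "?N i \<in> events" for i by auto
  have int: "integrable (perm_space m) (\<lambda>\<pi>. w i * indicator (?N i) \<pi>)" for i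
    using N by (intro integrable_mult_right integrable_real_indicator) (auto simp: less_top[symmetric])
  have eq: "(\<Sum>i\<in>bucket m D \<pi> (equi_hash m D \<pi> j) - {j}. w i) = ?f \<pi>" if "\<pi> permutes {1..m}" for \<pi>
    using that by (intro sum.mono_neutral_cong_left) (auto simp: bucket_def indicator_def)
  then have "prob {\<pi>. \<pi> permutes {1..m} \<and> T \<le> (\<Sum>i\<in>bucket m D \<pi> (equi_hash m D \<pi> j) - {j}. w i)}
     = prob {\<pi> \<in> space (perm_space m). T \<le> ?f \<pi>}"
    by (intro arg_cong[where f = prob]) auto
  also have "\<dots> \<le> expectation ?f / T"
    using T w by (intro integral_Markov_inequality_measure[where A = "{}"]
        Bochner_Integration.integrable_sum int AE_I2 sum_nonneg) auto
  also have "expectation ?f = (\<Sum>i\<in>{1..m} - {j}. w i * prob (?N i))"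
  proof -
    have "?N i \<inter> space (perm_space m) = ?N i" for i by auto
    then have "expectation (\<lambda>\<pi>. w i * indicator (?N i) \<pi>) = w i * prob (?N i)" for i
      by (simp only: integral_mult_right_zero Bochner_Integration.integral_indicator)
    then show ?thesis
      by (simp only: Bochner_Integration.integral_sum[OF int])
  qed
  also have "\<dots> \<le> (\<Sum>i\<in>{1..m} - {j}. w i * (1 / real D))"
    using w j D by (intro sum_mono mult_left_mono prob_collision_le) auto
  also have "\<dots> \<le> (\<Sum>i=1..m. w i * (1 / real D))"
    using w by (intro sum_mono2) auto
  also have "\<dots> = (\<Sum>i=1..m. w i) / real D"
    by (simp add: sum_divide_distrib)
  finally show ?thesis
    using T D by (simp add: divide_right_mono field_simps)
qed

section \<open>The space of random sign matrices\<close>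

lemma prob_space_signs: "prob_space (uniform_count_measure {-1, 1 :: real})"
  by (intro prob_space_uniform_count_measure) auto

lemma prob_space_sign_space: "prob_space (sign_space k m)"
  unfolding sign_space_def by (intro prob_space_PiM prob_space_signs)

lemma sets_PiM_signs:
  assumes "finite I"
  shows "sets (PiM I (\<lambda>_. uniform_count_measure {-1, 1 :: real})) = Pow (PiE I (\<lambda>_. {-1, 1}))"
proof -
  have "sets (PiM I (\<lambda>_. uniform_count_measure {-1, 1 :: real})) = sets (PiM I (\<lambda>_. count_space {-1, 1}))"
    by (intro sets_PiM_cong refl) (simp add: sets_uniform_count_measure)
  also have "\<dots> = Pow (PiE I (\<lambda>_. {-1, 1}))"
    using assms by (subst count_space_PiM_finite) auto
  finally show ?thesis .
qed

lemma space_sign_space [simp]: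
  "space (sign_space k m) = PiE ({1..k} \<times> {1..m}) (\<lambda>_. {-1, 1})"
  by (simp add: sign_space_def space_PiM space_uniform_count_measure)

lemma sets_sign_space [simp]:
  "sets (sign_space k m) = Pow (PiE ({1..k} \<times> {1..m}) (\<lambda>_. {-1, 1}))"
  by (simp add: sign_space_def sets_PiM_signs)

lemma measurable_sign_space [simp]:
  "f \<in> measurable (sign_space k m) N \<longleftrightarrow> f \<in> space (sign_space k m) \<rightarrow> space N"
  by (auto simp: measurable_def)

lemma indep_vars_sign_space:
  assumes "k \<ge> 1" "m \<ge> 1"
  shows "prob_space.indep_vars (sign_space k m) (\<lambda>_. uniform_count_measure {-1, 1}) (\<lambda>e a. a e) ({1..k} \<times> {1..m})"
proof -
  let ?I = "{1..k} \<times> {1..m}"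
  let ?U = "uniform_count_measure {-1, 1 :: real}"
  interpret prob_space "sign_space k m" by (rule prob_space_sign_space)
  have "distr (sign_space k m) (PiM ?I (\<lambda>_. ?U)) (\<lambda>a. \<lambda>e\<in>?I. a e) = distr (sign_space k m) (sign_space k m) (\<lambda>a. a)"
    unfolding sign_space_def
    by (intro distr_cong refl) (auto simp: space_PiM restrict_def fun_eq_iff PiE_def extensional_def)
  also have "\<dots> = PiM ?I (\<lambda>_. ?U)"
    by (simp add: sign_space_def)
  also have "\<dots> = (\<Pi>\<^sub>M e\<in>?I. distr (sign_space k m) ?U (\<lambda>a. a e))"
    unfolding sign_space_def
    by (intro PiM_cong refl distr_PiM_component[symmetric] prob_space_signs)
  finally show ?thesis
    using assms
    by (subst indep_vars_iff_distr_eq_PiM')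
       (fastforce simp: space_uniform_count_measure simp del: One_nat_def)+
qed

lemma integrable_sign_space [simp]: "integrable (sign_space k m) (f :: _ \<Rightarrow> real)"
proof -
  interpret prob_space "sign_space k m" by (rule prob_space_sign_space)
  have fin: "finite (PiE ({1..k} \<times> {1..m}) (\<lambda>_. {-1, 1 :: real}))"
    by (intro finite_PiE) auto
  show ?thesis
  proof (rule integrable_const_bound[of _ "Max ((\<lambda>a. \<bar>f a\<bar>) ` space (sign_space k m))"])
    show "AE a in sign_space k m. norm (f a) \<le> Max ((\<lambda>a. \<bar>f a\<bar>) ` space (sign_space k m))"
      using fin by (intro AE_I2) (auto intro!: Max_ge)
  qed auto
qed

definition flip :: "nat \<times> nat \<Rightarrow> (nat \<times> nat \<Rightarrow> real) \<Rightarrow> nat \<times> nat \<Rightarrow> real" where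
  "flip e a = a(e := - a e)"

text \<open>
  The law of a random sign matrix is invariant under changing the sign of one entry. This symmetry
  replaces conditioning on that entry in the computations below.
\<close>

lemma prob_flip:
  assumes e: "e \<in> {1..k} \<times> {1..m}"
  shows "measure (sign_space k m) {a \<in> space (sign_space k m). P (flip e a)} =
         measure (sign_space k m) {a \<in> space (sign_space k m). P a}"
proof -
  let ?I = "{1..k} \<times> {1..m}"
  let ?U = "uniform_count_measure {-1, 1 :: real}"
  interpret U: prob_space ?U by (rule prob_space_signs)
  interpret product_sigma_finite "\<lambda>_. ?U" ..
  have "flip e \<in> space (sign_space k m) \<rightarrow> space (sign_space k m)"
    using e by (force simp: flip_def PiE_def Pi_def extensional_def)
  then have meas: "flip e \<in> measurable (sign_space k m) (sign_space k m)" by simp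
  have "distr (sign_space k m) (sign_space k m) (flip e) = sign_space k m"
    unfolding sign_space_def
  proof (rule PiM_eqI)
    show "finite ?I" by simp
    show "sets (distr (Pi\<^sub>M ?I (\<lambda>_. ?U)) (Pi\<^sub>M ?I (\<lambda>_. ?U)) (flip e)) = sets (Pi\<^sub>M ?I (\<lambda>_. ?U))"
      by simp
    fix A assume A: "\<And>i. i \<in> ?I \<Longrightarrow> A i \<in> sets ?U"
    let ?A' = "A(e := uminus ` A e)"
    have A': "?A' i \<in> sets ?U" if "i \<in> ?I" for i
      using A[OF that] by (auto simp: sets_uniform_count_measure)
    have PA: "Pi\<^sub>E ?I A \<in> sets (Pi\<^sub>M ?I (\<lambda>_. ?U))"
      using A by (intro sets_PiM_I_finite) auto
    have "flip e -` Pi\<^sub>E ?I A \<inter> space (Pi\<^sub>M ?I (\<lambda>_. ?U)) = Pi\<^sub>E ?I ?A'"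
    proof (intro equalityI subsetI)
      fix a assume a: "a \<in> flip e -` Pi\<^sub>E ?I A \<inter> space (Pi\<^sub>M ?I (\<lambda>_. ?U))"
      have "a i \<in> ?A' i" if "i \<in> ?I" for i
      proof (cases "i = e")
        case True
        have "flip e a e \<in> A e" using a e by (auto simp: PiE_def Pi_def)
        then show ?thesis using True by (force simp: flip_def)
      next
        case False
        have "flip e a i \<in> A i" using a that by (auto simp: PiE_def Pi_def)
        then show ?thesis using False by (simp add: flip_def)
      qed
      then show "a \<in> Pi\<^sub>E ?I ?A'"
        using a by (auto simp: space_PiM PiE_def)
    next
      fix a assume a: "a \<in> Pi\<^sub>E ?I ?A'"
      have "flip e a i \<in> A i" if "i \<in> ?I" for i
      proof (cases "i = e")
        case True
        have "a e \<in> uminus ` A e" using a e by (force simp: PiE_def Pi_def)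
        then show ?thesis using True by (auto simp: flip_def)
      next
        case False
        then have "a i \<in> A i" using a that by (force simp: PiE_def Pi_def)
        then show ?thesis using False by (simp add: flip_def)
      qed
      moreover have "flip e a \<in> extensional ?I"
        using a e by (auto simp: PiE_def extensional_def flip_def)
      moreover have "a i \<in> {-1, 1}" if "i \<in> ?I" for i
        using a A'[OF that] that by (force simp: PiE_def Pi_def sets_uniform_count_measure)
      ultimately show "a \<in> flip e -` Pi\<^sub>E ?I A \<inter> space (Pi\<^sub>M ?I (\<lambda>_. ?U))"
        using a by (auto simp: space_PiM space_uniform_count_measure PiE_def)
    qed
    then have "emeasure (distr (Pi\<^sub>M ?I (\<lambda>_. ?U)) (Pi\<^sub>M ?I (\<lambda>_. ?U)) (flip e)) (Pi\<^sub>E ?I A)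
        = emeasure (Pi\<^sub>M ?I (\<lambda>_. ?U)) (Pi\<^sub>E ?I ?A')"
      using meas PA by (subst emeasure_distr) (simp_all only: sign_space_def)
    also have "\<dots> = (\<Prod>i\<in>?I. emeasure ?U (?A' i))"
      using A' by (subst emeasure_PiM) auto
    also have "\<dots> = (\<Prod>i\<in>?I. emeasure ?U (A i))"
    proof (intro prod.cong refl)
      fix i assume i: "i \<in> ?I"
      show "emeasure ?U (?A' i) = emeasure ?U (A i)"
      proof (cases "i = e")
        case True
        have "A e \<subseteq> {-1, 1}" using A[OF e] by (simp add: sets_uniform_count_measure)
        moreover from this have "uminus ` A e \<subseteq> {-1, 1}" by auto
        moreover have "card (uminus ` A e) = card (A e)" by (rule card_image) auto
        ultimately show ?thesis
          using True by (simp add: emeasure_uniform_count_measure)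
      qed simp
    qed
    finally show "emeasure (distr (Pi\<^sub>M ?I (\<lambda>_. ?U)) (Pi\<^sub>M ?I (\<lambda>_. ?U)) (flip e)) (Pi\<^sub>E ?I A)
        = (\<Prod>i\<in>?I. emeasure ?U (A i))" .
  qed
  then have "measure (sign_space k m) {a \<in> space (sign_space k m). P a} =
      measure (distr (sign_space k m) (sign_space k m) (flip e)) {a \<in> space (sign_space k m). P a}"
    by simp
  also have "\<dots> = measure (sign_space k m)
      (flip e -` {a \<in> space (sign_space k m). P a} \<inter> space (sign_space k m))"
    by (rule measure_distr[OF meas]) auto
  also have "flip e -` {a \<in> space (sign_space k m). P a} \<inter> space (sign_space k m) =
      {a \<in> space (sign_space k m). P (flip e a)}"
    using meas by (auto dest: measurable_space)
  finally show ?thesis by simp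
qed

text \<open>
  The rows are independent, so the number of rows in which an event occurs obeys Hoeffding's
  inequality. The hypothesis \<open>row\<close> says that the event in row \<open>r\<close> depends on row \<open>r\<close> only.
\<close>

lemma prob_many_rows_le:
  assumes m: "m \<ge> 1" and k: "k \<ge> 1"
    and row: "\<And>r a b. (\<And>i. i \<in> {1..m} \<Longrightarrow> a (r, i) = b (r, i)) \<Longrightarrow> B r a \<longleftrightarrow> B r b"
    and prob: "\<And>r. r \<in> {1..k} \<Longrightarrow>
      measure (sign_space k m) {a \<in> space (sign_space k m). B r a} \<le> \<beta>"
    and \<epsilon>: "\<epsilon> \<ge> 0"
  shows "measure (sign_space k m)
      {a \<in> space (sign_space k m). (\<beta> + \<epsilon>) * real k \<le> real (card {r \<in> {1..k}. B r a})}
    \<le> exp (- 2 * real k * \<epsilon>\<^sup>2)"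
proof -
  let ?I = "{1..k} \<times> {1..m}"
  let ?U = "uniform_count_measure {-1, 1 :: real}"
  interpret prob_space "sign_space k m" by (rule prob_space_sign_space)
  define X where "X = (\<lambda>r a. of_bool (B r a) :: real)"
  have "indep_vars (\<lambda>r. PiM ({r} \<times> {1..m}) (\<lambda>_. ?U)) (\<lambda>r a. restrict (\<lambda>e. a e) ({r} \<times> {1..m})) {1..k}"
    by (rule indep_vars_restrict[OF indep_vars_sign_space[OF k m]])
       (auto simp: disjoint_family_on_def)
  then have "indep_vars (\<lambda>_. borel) (\<lambda>r a. X r (restrict (\<lambda>e. a e) ({r} \<times> {1..m}))) {1..k}"
    by (rule indep_vars_compose2) (simp add: measurable_def sets_PiM_signs space_PiM space_uniform_count_measure)
  moreover have "X r (restrict (\<lambda>e. a e) ({r} \<times> {1..m})) = X r a" for r a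
    unfolding X_def by (rule arg_cong[where f = of_bool], rule row) auto
  ultimately have indep: "indep_vars (\<lambda>_. borel) X {1..k}"
    by simp
  interpret Hoeffding_ineq "sign_space k m" "{1..k}" X "\<lambda>_. 0" "\<lambda>_. 1" "\<Sum>r=1..k. expectation (X r)"
    by unfold_locales (use indep in \<open>auto simp: X_def\<close>)
  have "expectation (X r) \<le> \<beta>" if "r \<in> {1..k}" for r
  proof -
    have "expectation (X r) = (\<integral>a. indicator {a \<in> space (sign_space k m). B r a} a \<partial>sign_space k m)"
      by (intro Bochner_Integration.integral_cong refl) (auto simp: X_def indicator_def)
    also have "\<dots> = prob {a \<in> space (sign_space k m). B r a}"
      by (subst Bochner_Integration.integral_indicator) (auto intro!: arg_cong[where f = prob])
    finally show ?thesis using prob[OF that] by simp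
  qed
  then have "(\<Sum>r=1..k. expectation (X r)) \<le> (\<Sum>r=1..k. \<beta>)"
    by (intro sum_mono) auto
  then have \<mu>: "(\<Sum>r=1..k. expectation (X r)) \<le> \<beta> * real k" by (simp add: mult.commute)
  have sumX: "(\<Sum>r=1..k. X r a) = real (card {r \<in> {1..k}. B r a})" for a
    by (simp add: X_def Int_def)
  have "prob {a \<in> space (sign_space k m). (\<beta> + \<epsilon>) * real k \<le> real (card {r \<in> {1..k}. B r a})}
    \<le> prob {a \<in> space (sign_space k m). (\<Sum>r=1..k. X r a) \<ge> (\<Sum>r=1..k. expectation (X r)) + \<epsilon> * real k}"
    using \<mu> by (intro finite_measure_mono) (auto simp: sumX algebra_simps simp del: One_nat_def)
  also have "\<dots> \<le> exp (- 2 * (\<epsilon> * real k)\<^sup>2 / (\<Sum>r=1..k. (1 - 0)\<^sup>2))"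
    using \<epsilon> k by (intro Hoeffding_ineq_ge) auto
  also have "- 2 * (\<epsilon> * real k)\<^sup>2 / (\<Sum>r=1..k. (1 - 0)\<^sup>2) = - 2 * real k * \<epsilon>\<^sup>2"
    using k by (simp add: power2_eq_square)
  finally show ?thesis .
qed

section \<open>Preconditioning isolates a dominant coordinate\<close>

lemma exp_le_tenth: "exp (- (5 / 2) :: real) \<le> 1 / 10"
proof -
  have "1 + 1 / 2 + (1 / 2)\<^sup>2 / 2 \<le> exp (1 / 2 :: real)"
    by (rule exp_lower_Taylor_quadratic) simp
  then have "(13 / 8) ^ 5 \<le> exp (1 / 2 :: real) ^ 5"
    by (intro power_mono) (simp_all add: power2_eq_square)
  also have "\<dots> = exp (5 / 2)"
    by (simp flip: exp_of_nat_mult)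
  finally have "10 \<le> exp (5 / 2 :: real)"
    by (simp add: power_divide)
  then show ?thesis
    by (simp add: exp_minus field_simps)
qed

lemma sign_space_values:
  assumes "a \<in> space (sign_space k m)" "r \<in> {1..k}" "i \<in> {1..m}"
  shows "a (r, i) = 1 \<or> a (r, i) = -1"
  using assms by (fastforce simp del: One_nat_def)

lemma measurable_signs: "f \<in> measurable (uniform_count_measure {-1, 1 :: real}) N \<longleftrightarrow> f \<in> {-1, 1} \<rightarrow> space N"
  by (auto simp: measurable_def space_uniform_count_measure sets_uniform_count_measure)

lemma expectation_sign:
  assumes "e \<in> {1..k} \<times> {1..m}"
  shows "(\<integral>a. a e \<partial>sign_space k m) = 0"
proof -
  let ?U = "uniform_count_measure {-1, 1 :: real}"
  have "distr (sign_space k m) ?U (\<lambda>a. a e) = ?U"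
    unfolding sign_space_def by (intro distr_PiM_component prob_space_signs assms)
  then have "(\<integral>y. y \<partial>?U) = (\<integral>y. y \<partial>distr (sign_space k m) ?U (\<lambda>a. a e))"
    by simp
  also have "\<dots> = (\<integral>a. a e \<partial>sign_space k m)"
  proof (rule integral_distr)
    show "(\<lambda>a. a e) \<in> measurable (sign_space k m) ?U"
      using assms by (fastforce simp: space_uniform_count_measure simp del: One_nat_def)
    show "(\<lambda>y. y) \<in> borel_measurable ?U"
      by (simp add: measurable_signs)
  qed
  finally show ?thesis
    by (simp add: integral_uniform_count_measure)
qed

text \<open>
  The summands are independent, centred and bounded by \<open>\<bar>x i\<bar>\<close>; Hoeffding's inequality bounds the
  probability by \<open>2 exp (- c\<^sup>2 / (2 \<Sum> x i\<^sup>2))\<close>. It needs a positive sum of squares, hence the case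
  distinction.
\<close>

lemma prob_row_sum_ge:
  assumes r: "r \<in> {1..k}" and I: "I \<subseteq> {1..m}" and c: "c > 0" and x: "5 * (\<Sum>i\<in>I. (x i)\<^sup>2) \<le> c\<^sup>2"
  shows "measure (sign_space k m)
    {a \<in> space (sign_space k m). c \<le> \<bar>\<Sum>i\<in>I. a (r, i) * x i\<bar>} \<le> 2 * exp (- (5 / 2))"
proof (cases "(\<Sum>i\<in>I. (x i)\<^sup>2) = 0")
  case True
  have "finite I" using I finite_subset by blast
  with True have "x i = 0" if "i \<in> I" for i
    using that by (simp add: sum_nonneg_eq_0_iff)
  then have "{a \<in> space (sign_space k m). c \<le> \<bar>\<Sum>i\<in>I. a (r, i) * x i\<bar>} = {}"
    using c by auto
  then show ?thesis by (simp only: measure_empty) simp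
next
  case False
  have fin: "finite I" using I finite_subset by blast
  interpret prob_space "sign_space k m" by (rule prob_space_sign_space)
  have km: "k \<ge> 1" "m \<ge> 1" using r I False by auto (metis atLeastAtMost_iff ex_in_conv le_trans subset_iff sum.empty)
  define X where "X = (\<lambda>e (a :: nat \<times> nat \<Rightarrow> real). a e * x (snd e))"
  have row: "(\<Sum>e\<in>{r} \<times> I. f e) = (\<Sum>i\<in>I. f (r, i))" for f :: "nat \<times> nat \<Rightarrow> real"
    by (rule sum.reindex_bij_witness[of _ "\<lambda>i. (r, i)" snd]) auto
  have "indep_vars (\<lambda>_. borel) X ({r} \<times> I)"
    unfolding X_def
    by (rule indep_vars_compose2[OF indep_vars_subset[OF indep_vars_sign_space[OF km]]])
       (use r I in \<open>auto simp: measurable_signs\<close>)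
  then interpret Hoeffding_ineq "sign_space k m" "{r} \<times> I" X "\<lambda>e. - \<bar>x (snd e)\<bar>" "\<lambda>e. \<bar>x (snd e)\<bar>" 0
  proof unfold_locales
    show "finite ({r} \<times> I)" using fin by simp
    fix e assume e: "e \<in> {r} \<times> I"
    have "X e a \<in> {- \<bar>x (snd e)\<bar>..\<bar>x (snd e)\<bar>}" if "a \<in> space (sign_space k m)" for a
    proof -
      have "snd e \<in> {1..m}" "e = (r, snd e)" using e I by auto
      then have "a e = 1 \<or> a e = -1" using sign_space_values[OF that r] by metis
      then show ?thesis by (auto simp: X_def)
    qed
    then show "AE a in sign_space k m. X e a \<in> {- \<bar>x (snd e)\<bar>..\<bar>x (snd e)\<bar>}"
      by (intro AE_I2)
  next
    have "expectation (X e) = 0" if "e \<in> {r} \<times> I" for e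
      unfolding X_def using expectation_sign[of e k m] that r I by auto
    then show "0 \<equiv> (\<Sum>e\<in>{r} \<times> I. expectation (X e))"
      by (intro eq_reflection) simp
  qed
  have sq: "(\<Sum>e\<in>{r} \<times> I. (\<bar>x (snd e)\<bar> - - \<bar>x (snd e)\<bar>)\<^sup>2) = 4 * (\<Sum>i\<in>I. (x i)\<^sup>2)"
    unfolding row by (simp add: sum_distrib_left power2_eq_square)
  have pos: "(\<Sum>i\<in>I. (x i)\<^sup>2) > 0"
    using False by (simp add: sum_nonneg less_le)
  have "prob {a \<in> space (sign_space k m). c \<le> \<bar>\<Sum>i\<in>I. a (r, i) * x i\<bar>} =
      prob {a \<in> space (sign_space k m). c \<le> \<bar>(\<Sum>e\<in>{r} \<times> I. X e a) - 0\<bar>}"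
    unfolding row by (simp add: X_def)
  also have "\<dots> \<le> 2 * exp (- 2 * c\<^sup>2 / (4 * (\<Sum>i\<in>I. (x i)\<^sup>2)))"
    unfolding sq[symmetric] using pos c sq by (intro Hoeffding_ineq_abs_ge) simp_all
  also have "\<dots> \<le> 2 * exp (- (5 / 2))"
    using pos x by (simp add: field_simps)
  finally show ?thesis .
qed

text \<open>
  Normalised by the sign of \<open>x j\<close> and the entry in column \<open>j\<close>, the row sum is \<open>\<bar>x j\<bar> + Z\<close>, where \<open>Z\<close>
  collects the other columns. A wrong sign forces \<open>Z \<le> - \<bar>x j\<bar>\<close>. Flipping the entry in column \<open>j\<close> negates \<open>Z\<close>,
  so this one-sided event has at most half the probability of the two-sided one. That halving is
  what brings the bound below 1/10, safely under the threshold 1/6 of the preconditioner.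
\<close>

lemma prob_wrong_sign_le:
  assumes r: "r \<in> {1..k}" and J: "J \<subseteq> {1..m}" "j \<in> J" and xj: "x j \<noteq> 0"
    and x: "5 * (\<Sum>i\<in>J - {j}. (x i)\<^sup>2) \<le> (x j)\<^sup>2"
  shows "measure (sign_space k m)
    {a \<in> space (sign_space k m). observed_sign J x a r \<noteq> sgn (x j) * a (r, j)} \<le> 1 / 10"
proof -
  interpret prob_space "sign_space k m" by (rule prob_space_sign_space)
  define V where "V = (\<lambda>a :: nat \<times> nat \<Rightarrow> real. \<Sum>i\<in>J - {j}. a (r, i) * x i)"
  define Z where "Z = (\<lambda>a. a (r, j) * sgn (x j) * V a)"
  let ?c = "\<bar>x j\<bar>"
  have fin: "finite J" using J finite_subset by blast
  have j: "j \<in> {1..m}" using J by blast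
  have Z_flip: "Z (flip (r, j) a) = - Z a" for a
  proof -
    have "V (flip (r, j) a) = V a"
      unfolding V_def by (intro sum.cong) (auto simp: flip_def)
    then show ?thesis by (simp add: Z_def flip_def)
  qed
  have "Z a \<le> - ?c" if a: "a \<in> space (sign_space k m)" and wrong: "observed_sign J x a r \<noteq> sgn (x j) * a (r, j)" for a
  proof (rule ccontr)
    assume "\<not> Z a \<le> - ?c"
    moreover have "(\<Sum>i\<in>J. a (r, i) * x i) = a (r, j) * x j + V a"
      unfolding V_def using fin J by (simp add: sum.remove)
    ultimately show False
      using sign_space_values[OF a r j] wrong xj
      by (auto simp: observed_sign_def sgn1_def Z_def sgn_if abs_if split: if_splits)
  qed
  then have "prob {a \<in> space (sign_space k m). observed_sign J x a r \<noteq> sgn (x j) * a (r, j)}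
      \<le> prob {a \<in> space (sign_space k m). Z a \<le> - ?c}"
    by (intro finite_measure_mono) auto
  moreover have "prob {a \<in> space (sign_space k m). Z a \<le> - ?c} = prob {a \<in> space (sign_space k m). ?c \<le> Z a}"
    using prob_flip[of "(r, j)" k m "\<lambda>a. ?c \<le> Z a"] r j
    by (simp add: Z_flip le_minus_iff del: space_sign_space)
  moreover have "prob {a \<in> space (sign_space k m). Z a \<le> - ?c} + prob {a \<in> space (sign_space k m). ?c \<le> Z a}
     \<le> 2 * exp (- (5 / 2))"
  proof -
    have "prob {a \<in> space (sign_space k m). Z a \<le> - ?c} + prob {a \<in> space (sign_space k m). ?c \<le> Z a}
       = prob ({a \<in> space (sign_space k m). Z a \<le> - ?c} \<union> {a \<in> space (sign_space k m). ?c \<le> Z a})"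
      using xj by (intro finite_measure_Union[symmetric]) auto
    also have "\<dots> \<le> prob {a \<in> space (sign_space k m). ?c \<le> \<bar>V a\<bar>}"
    proof (intro finite_measure_mono subsetI)
      fix a assume a: "a \<in> {a \<in> space (sign_space k m). Z a \<le> - ?c} \<union> {a \<in> space (sign_space k m). ?c \<le> Z a}"
      then have sp: "a \<in> space (sign_space k m)" by blast
      have "\<bar>Z a\<bar> = \<bar>V a\<bar>"
        using sign_space_values[OF sp r j] xj by (auto simp: Z_def abs_mult sgn_if)
      then show "a \<in> {a \<in> space (sign_space k m). ?c \<le> \<bar>V a\<bar>}"
        using a sp by auto
    qed auto
    also have "\<dots> \<le> 2 * exp (- (5 / 2))"
      unfolding V_def using r J xj x by (intro prob_row_sum_ge) auto
    finally show ?thesis .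
  qed
  ultimately show ?thesis
    using exp_le_tenth by linarith
qed

text \<open>
  Flipping the entry \<open>(r, i)\<close> exchanges the event and its complement.
\<close>

lemma prob_agree:
  assumes "r \<in> {1..k}" "i \<in> {1..m}" "j \<in> {1..m}" "i \<noteq> j" "c = 1 \<or> c = -1"
  shows "measure (sign_space k m) {a \<in> space (sign_space k m). a (r, i) = c * a (r, j)} = 1 / 2"
proof -
  interpret prob_space "sign_space k m" by (rule prob_space_sign_space)
  let ?A = "{a \<in> space (sign_space k m). a (r, i) = c * a (r, j)}"
  have "{a \<in> space (sign_space k m). flip (r, i) a (r, i) = c * flip (r, i) a (r, j)} = space (sign_space k m) - ?A"
  proof -
    have "- a (r, i) = c * a (r, j) \<longleftrightarrow> a (r, i) \<noteq> c * a (r, j)" if "a \<in> space (sign_space k m)" for a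
      using sign_space_values[OF that assms(1,2)] sign_space_values[OF that assms(1,3)] assms(5) by auto
    then show ?thesis
      using assms(4) by (auto simp: flip_def simp del: space_sign_space)
  qed
  then have "prob ?A = prob (space (sign_space k m) - ?A)"
    using prob_flip[of "(r, i)" k m "\<lambda>a. a (r, i) = c * a (r, j)"] assms by simp
  also have "\<dots> = 1 - prob ?A"
    by (intro prob_compl) auto
  finally show ?thesis by simp
qed

lemma hamming_signs:
  assumes "\<And>r. r \<in> {1..k} \<Longrightarrow> a r = 1 \<or> a r = -1" "\<And>r. r \<in> {1..k} \<Longrightarrow> b r = 1 \<or> b r = -1"
  shows "hamming k a b = real (card {r \<in> {1..k}. a r \<noteq> b r})"
proof -
  have "(\<Sum>r=1..k. \<bar>a r - b r\<bar>) = (\<Sum>r=1..k. 2 * of_bool (a r \<noteq> b r))"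
    using assms by (intro sum.cong refl) force
  then show ?thesis
    by (simp add: hamming_def Int_def flip: sum_distrib_left)
qed

lemma observed_sign_values: "observed_sign J x a r = 1 \<or> observed_sign J x a r = -1"
  by (simp add: observed_sign_def sgn1_def)

text \<open>
  Up to global signs, the columns \<open>a\<^sub>i\<close> and \<open>a\<^sub>j\<close> both differ from the observed signs in at most \<open>k / 6\<close>
  rows, so they differ from each other in at most \<open>k / 3\<close> rows.
\<close>

lemma survivor_agrees:
  assumes a: "a \<in> space (sign_space k m)" and J: "J \<subseteq> {1..m}" "i \<in> J" "j \<in> J" and xj: "x j \<noteq> 0"
    and wrong: "real (card {r \<in> {1..k}. observed_sign J x a r \<noteq> sgn (x j) * a (r, j)}) \<le> real k / 6"
    and i: "i \<in> run m (precond k J a) x"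
  shows "\<exists>c\<in>{1, -1}. 2 / 3 * real k \<le> real (card {r \<in> {1..k}. a (r, i) = c * a (r, j)})"
proof -
  let ?s = "observed_sign J x a"
  let ?W = "{r \<in> {1..k}. ?s r \<noteq> sgn (x j) * a (r, j)}"
  obtain \<eta> :: real where \<eta>: "\<eta> = 1 \<or> \<eta> = -1"
    and ham: "hamming k (\<lambda>r. a (r, i)) (\<lambda>r. \<eta> * ?s r) \<le> real k / 6"
  proof -
    have "hamming k (\<lambda>r. a (r, i)) ?s \<le> real k / 6 \<or> hamming k (\<lambda>r. a (r, i)) (\<lambda>r. - ?s r) \<le> real k / 6"
      using i by (simp add: run_precond[OF J(1)])
    then show ?thesis
      using that[of 1] that[of "-1"] by auto
  qed
  have sv: "\<eta> * ?s r = 1 \<or> \<eta> * ?s r = -1" for r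
    using \<eta> observed_sign_values[of J x a r] by auto
  have i_val: "a (r, i) = 1 \<or> a (r, i) = -1" if "r \<in> {1..k}" for r
    using sign_space_values[OF a that] J by blast
  let ?U = "{r \<in> {1..k}. a (r, i) \<noteq> \<eta> * ?s r}"
  have U: "real (card ?U) \<le> real k / 6"
    using ham by (subst (asm) hamming_signs) (use i_val sv in auto)
  let ?c = "\<eta> * sgn (x j)"
  let ?G = "{r \<in> {1..k}. a (r, i) = ?c * a (r, j)}"
  have "{1..k} \<subseteq> ?G \<union> (?U \<union> ?W)"
    by auto
  then have "card {1..k} \<le> card (?G \<union> (?U \<union> ?W))"
    by (intro card_mono) auto
  also have "\<dots> \<le> card ?G + (card ?U + card ?W)"
    by (intro order_trans[OF card_Un_le] add_left_mono card_Un_le)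
  finally have "real k \<le> real (card ?G) + (real (card ?U) + real (card ?W))"
    by simp
  then have "2 / 3 * real k \<le> real (card ?G)"
    using U wrong by simp
  moreover have "?c \<in> {1, -1}"
    using \<eta> xj by (auto simp: sgn_if)
  ultimately show ?thesis by blast
qed

lemma survives_precond:
  assumes a: "a \<in> space (sign_space k m)" and J: "J \<subseteq> {1..m}" "j \<in> J" and xj: "x j \<noteq> 0"
    and wrong: "real (card {r \<in> {1..k}. observed_sign J x a r \<noteq> sgn (x j) * a (r, j)}) \<le> real k / 6"
  shows "j \<in> run m (precond k J a) x"
proof -
  let ?s = "observed_sign J x a"
  have a_val: "a (r, j) = 1 \<or> a (r, j) = -1" if "r \<in> {1..k}" for r
    using sign_space_values[OF a that] J by blast
  have sv: "?s r = 1 \<or> ?s r = -1" for r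
    by (rule observed_sign_values)
  have "hamming k (\<lambda>r. a (r, j)) (\<lambda>r. sgn (x j) * ?s r) =
      real (card {r \<in> {1..k}. a (r, j) \<noteq> sgn (x j) * ?s r})"
    using xj a_val sv by (intro hamming_signs) (auto simp: sgn_if)
  also have "{r \<in> {1..k}. a (r, j) \<noteq> sgn (x j) * ?s r} = {r \<in> {1..k}. ?s r \<noteq> sgn (x j) * a (r, j)}"
    using xj by (auto simp: sgn_if)
  finally have "hamming k (\<lambda>r. a (r, j)) (\<lambda>r. sgn (x j) * ?s r) \<le> real k / 6"
    using wrong by simp
  then show ?thesis
    using xj J by (auto simp: run_precond[OF J(1)] sgn_if split: if_splits)
qed

text \<open>
  The index \<open>j\<close> is lost only if the observed sign is wrong in a sixth of the rows instead of the
  expected tenth. Another index that survives has to agree with \<open>j\<close> in two thirds of the rows instead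
  of the expected half; its probability is at most \<open>2 / 2 ^ 30\<close>, and Markov's inequality applied to the surviving
  squared mass allows the gain of a factor \<open>4000000\<close>. This is the square of 2000, an upper bound for
  \<open>516 * sqrt (2 * ln 64)\<close>, the ratio demanded by Spot with failure probability 1/4.
\<close>

lemma prob_precond_isolates:
  assumes J: "J \<subseteq> {1..m}" "j \<in> J" and xj: "x j \<noteq> 0"
    and x: "5 * (\<Sum>i\<in>J - {j}. (x i)\<^sup>2) \<le> (x j)\<^sup>2"
  shows "measure (sign_space 551 m) {a \<in> space (sign_space 551 m).
      j \<in> run m (precond 551 J a) x \<and>
      4000000 * (\<Sum>i\<in>run m (precond 551 J a) x - {j}. (x i)\<^sup>2) \<le> (x j)\<^sup>2} \<ge> 4 / 5"
proof -
  define k :: nat where "k = 551"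
  let ?M = "sign_space k m"
  interpret prob_space ?M by (rule prob_space_sign_space)
  have fin: "finite J" using J finite_subset by blast
  have j: "j \<in> {1..m}" using J by blast
  then have m: "m \<ge> 1" by simp
  define Wrong where "Wrong = {a \<in> space ?M.
    real k / 6 \<le> real (card {r \<in> {1..k}. observed_sign J x a r \<noteq> sgn (x j) * a (r, j)})}"
  define T where "T = (\<lambda>c i. {a \<in> space ?M. 2 / 3 * real k \<le> real (card {r \<in> {1..k}. a (r, i) = c * a (r, j)})})"
  define E where "E = (\<lambda>a. \<Sum>i\<in>J - {j}. (x i)\<^sup>2 * (indicator (T 1 i) a + indicator (T (-1) i) a))"
  have "prob {a \<in> space ?M. (1 / 10 + 1 / 15) * real k
      \<le> real (card {r \<in> {1..k}. observed_sign J x a r \<noteq> sgn (x j) * a (r, j)})}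
    \<le> exp (- 2 * real k * (1 / 15)\<^sup>2)"
  proof (rule prob_many_rows_le[OF m])
    fix r and a b :: "nat \<times> nat \<Rightarrow> real"
    assume ab: "\<And>i. i \<in> {1..m} \<Longrightarrow> a (r, i) = b (r, i)"
    have "(\<Sum>i\<in>J. a (r, i) * x i) = (\<Sum>i\<in>J. b (r, i) * x i)"
      using J ab by (intro sum.cong) auto
    then show "(observed_sign J x a r \<noteq> sgn (x j) * a (r, j)) =
        (observed_sign J x b r \<noteq> sgn (x j) * b (r, j))"
      using ab[OF j] by (simp add: observed_sign_def)
  qed (use prob_wrong_sign_le[OF _ J xj x] in \<open>simp_all add: k_def\<close>)
  also have "\<dots> \<le> exp (- (5 / 2))"
    by (simp add: k_def power2_eq_square)
  finally have Wrong: "prob Wrong \<le> 1 / 10"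
    using exp_le_tenth unfolding Wrong_def by simp
  have T: "prob (T c i) \<le> 1 / 2 ^ 30" if i: "i \<in> J - {j}" and c: "c = 1 \<or> c = -1" for c i
  proof -
    have "prob {a \<in> space ?M. (1 / 2 + 1 / 6) * real k \<le> real (card {r \<in> {1..k}. a (r, i) = c * a (r, j)})}
      \<le> exp (- 2 * real k * (1 / 6)\<^sup>2)"
    proof (rule prob_many_rows_le[OF m])
      have i': "i \<in> {1..m}" using J i by blast
      show "(a (r, i) = c * a (r, j)) = (b (r, i) = c * b (r, j))"
        if "\<And>i. i \<in> {1..m} \<Longrightarrow> a (r, i) = b (r, i)" for r and a b :: "nat \<times> nat \<Rightarrow> real"
        using that[OF i'] that[OF j] by simp
      show "prob {a \<in> space ?M. a (r, i) = c * a (r, j)} \<le> 1 / 2" if "r \<in> {1..k}" for r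
        using prob_agree[OF that i' j _ c] i by simp
    qed (simp_all add: k_def)
    also have "\<dots> \<le> exp (- 30)"
      by (simp add: k_def power2_eq_square)
    also have "\<dots> \<le> 1 / 2 ^ 30"
    proof -
      have "2 \<le> exp (1 :: real)"
        using exp_ge_add_one_self[of 1] by simp
      then have "2 ^ 30 \<le> exp (1 :: real) ^ 30"
        by (intro power_mono) simp_all
      also have "\<dots> = exp 30"
        by (simp flip: exp_of_nat_mult)
      finally show ?thesis
        by (simp add: exp_minus field_simps)
    qed
    finally show ?thesis by (simp add: T_def)
  qed
  have "expectation E = (\<Sum>i\<in>J - {j}. (x i)\<^sup>2 * (prob (T 1 i) + prob (T (-1) i)))"
  proof -
    have "T c i \<inter> space ?M = T c i" for c i by (auto simp: T_def)
    then show ?thesis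
      unfolding E_def
      by (subst Bochner_Integration.integral_sum) (simp_all add: Bochner_Integration.integral_add)
  qed
  also have "\<dots> \<le> (\<Sum>i\<in>J - {j}. (x i)\<^sup>2 * (1 / 2 ^ 30 + 1 / 2 ^ 30))"
    using T by (intro sum_mono mult_left_mono add_mono) auto
  also have "\<dots> = (\<Sum>i\<in>J - {j}. (x i)\<^sup>2) / 2 ^ 29"
    by (simp add: sum_divide_distrib)
  also have "\<dots> \<le> (x j)\<^sup>2 / 5 / 2 ^ 29"
    using x by simp
  finally have EE: "expectation E \<le> (x j)\<^sup>2 / 5 / 2 ^ 29" .
  have "prob {a \<in> space ?M. (x j)\<^sup>2 / 4000000 \<le> E a} \<le> expectation E / ((x j)\<^sup>2 / 4000000)"
    using xj by (intro integral_Markov_inequality_measure[where A = "{}"])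
      (auto simp: E_def intro!: sum_nonneg)
  also have "\<dots> \<le> (x j)\<^sup>2 / 5 / 2 ^ 29 / ((x j)\<^sup>2 / 4000000)"
    using EE by (intro divide_right_mono) auto
  also have "\<dots> \<le> 1 / 10"
    using xj by simp
  finally have Markov: "prob {a \<in> space ?M. (x j)\<^sup>2 / 4000000 \<le> E a} \<le> 1 / 10" .
  let ?Good = "{a \<in> space ?M. j \<in> run m (precond k J a) x \<and>
      4000000 * (\<Sum>i\<in>run m (precond k J a) x - {j}. (x i)\<^sup>2) \<le> (x j)\<^sup>2}"
  \<comment> \<open>Outside these two events every survivor \<open>i \<noteq> j\<close> lies in \<open>T 1 i\<close> or \<open>T (-1) i\<close> and is counted in \<open>E\<close>.\<close>
  have "space ?M - ?Good \<subseteq> Wrong \<union> {a \<in> space ?M. (x j)\<^sup>2 / 4000000 \<le> E a}"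
  proof (rule subsetI, rule ccontr)
    fix a assume a: "a \<in> space ?M - ?Good" and "a \<notin> Wrong \<union> {a \<in> space ?M. (x j)\<^sup>2 / 4000000 \<le> E a}"
    then have sp: "a \<in> space ?M" and E: "E a < (x j)\<^sup>2 / 4000000"
      and few: "real (card {r \<in> {1..k}. observed_sign J x a r \<noteq> sgn (x j) * a (r, j)}) \<le> real k / 6"
      by (auto simp: Wrong_def simp del: space_sign_space)
    let ?J' = "run m (precond k J a) x"
    have sub: "?J' \<subseteq> J" by (auto simp: run_precond[OF J(1)])
    have "(\<Sum>i\<in>?J' - {j}. (x i)\<^sup>2) \<le>
        (\<Sum>i\<in>?J' - {j}. (x i)\<^sup>2 * (indicator (T 1 i) a + indicator (T (-1) i) a))"
    proof (rule sum_mono)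
      fix i assume i: "i \<in> ?J' - {j}"
      then obtain c where "c \<in> {1, -1}" "a \<in> T c i"
        using survivor_agrees[OF sp J(1) _ J(2) xj few, of i] sub sp unfolding T_def by blast
      then have "1 \<le> indicator (T 1 i) a + (indicator (T (-1) i) a :: real)"
        by (auto simp: indicator_def)
      then show "(x i)\<^sup>2 \<le> (x i)\<^sup>2 * (indicator (T 1 i) a + indicator (T (-1) i) a)"
        by (simp add: mult_le_cancel_left1)
    qed
    also have "\<dots> \<le> E a"
      unfolding E_def using fin sub by (intro sum_mono2) auto
    finally have "4000000 * (\<Sum>i\<in>?J' - {j}. (x i)\<^sup>2) \<le> (x j)\<^sup>2"
      using E by simp
    moreover have "j \<in> ?J'"
      by (rule survives_precond[OF sp J xj few])
    ultimately show False using a sp by blast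
  qed
  then have "prob (space ?M - ?Good) \<le> prob (Wrong \<union> {a \<in> space ?M. (x j)\<^sup>2 / 4000000 \<le> E a})"
    by (intro finite_measure_mono) (auto simp: Wrong_def)
  also have "\<dots> \<le> prob Wrong + prob {a \<in> space ?M. (x j)\<^sup>2 / 4000000 \<le> E a}"
    by (intro measure_Un_le) (auto simp: Wrong_def)
  also have "\<dots> \<le> 1 / 5"
    using Wrong Markov by simp
  also have "prob (space ?M - ?Good) = 1 - prob ?Good"
    by (intro prob_compl) auto
  finally show ?thesis
    by (simp add: k_def)
qed

section \<open>Probabilities on product spaces\<close>

lemma prob_pair_measure_ge:
  assumes M: "prob_space M" and N: "prob_space N" and E: "E \<in> sets (M \<Otimes>\<^sub>M N)" and G: "G \<in> sets M"
    and c: "0 \<le> c" and fibre: "\<And>a. a \<in> G \<Longrightarrow> c \<le> measure N {b \<in> space N. (a, b) \<in> E}"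
  shows "measure M G * c \<le> measure (M \<Otimes>\<^sub>M N) E"
proof -
  interpret M: prob_space M by (rule M)
  interpret N: prob_space N by (rule N)
  interpret P: pair_prob_space M N ..
  have "ennreal (measure M G * c) = (\<integral>\<^sup>+a. ennreal c * indicator G a \<partial>M)"
    using G c by (simp add: nn_integral_cmult M.emeasure_eq_measure ennreal_mult' mult.commute)
  also have "\<dots> \<le> (\<integral>\<^sup>+a. emeasure N (Pair a -` E) \<partial>M)"
  proof (intro nn_integral_mono)
    fix a
    have "Pair a -` E = {b \<in> space N. (a, b) \<in> E}"
      using sets.sets_into_space[OF E] by (auto simp: space_pair_measure)
    then show "ennreal c * indicator G a \<le> emeasure N (Pair a -` E)"
      using fibre[of a] c by (auto simp: indicator_def N.emeasure_eq_measure)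
  qed
  also have "\<dots> = emeasure (M \<Otimes>\<^sub>M N) E"
    by (rule N.emeasure_pair_measure_alt[OF E, symmetric])
  finally show ?thesis
    by (simp add: P.emeasure_eq_measure)
qed

lemma prob_space_pair_measure:
  assumes "prob_space M" "prob_space N"
  shows "prob_space (M \<Otimes>\<^sub>M N)"
proof -
  interpret M: prob_space M by fact
  interpret N: prob_space N by fact
  interpret pair_prob_space M N ..
  show ?thesis by unfold_locales
qed

lemma prob_component:
  assumes "\<And>i. i \<in> I \<Longrightarrow> prob_space (M i)" "i \<in> I" "A \<in> sets (M i)"
  shows "measure (PiM I M) {\<omega> \<in> space (PiM I M). \<omega> i \<in> A} = measure (M i) A"
proof -
  have "measure (M i) A = measure (distr (PiM I M) (M i) (\<lambda>\<omega>. \<omega> i)) A"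
    using distr_PiM_component[of I M i] assms by simp
  also have "\<dots> = measure (PiM I M) ((\<lambda>\<omega>. \<omega> i) -` A \<inter> space (PiM I M))"
    using assms by (intro measure_distr measurable_component_singleton)
  also have "(\<lambda>\<omega>. \<omega> i) -` A \<inter> space (PiM I M) = {\<omega> \<in> space (PiM I M). \<omega> i \<in> A}"
    by auto
  finally show ?thesis by simp
qed

section \<open>Recovery of a coordinate from its bucket\<close>

lemma lp_norm_2: "lp_norm 2 J x = sqrt (\<Sum>j\<in>J. (x j)\<^sup>2)"
  by (simp add: lp_norm_def powr_half_sqrt sum_nonneg)

lemma spot_delta_bounds: "0 < spot_delta v" "spot_delta v < 1"
  by (cases v; simp)+

text \<open>
  The factor by which a coordinate has to exceed the Euclidean norm of the rest of its bucket. For the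
  basic version it is the requirement of Spot with failure probability 1/3, for the other one the
  requirement of the preconditioner.
\<close>

primrec noise_ratio :: "version \<Rightarrow> real" where
  "noise_ratio Basic = 387 * sqrt (2 * ln 48)"
| "noise_ratio Preconditioned = sqrt 5"

text \<open>
  The reciprocal of the bound on the probability that the bucket of a coordinate is too noisy.
\<close>

primrec bucket_factor :: "version \<Rightarrow> real" where
  "bucket_factor Basic = 4"
| "bucket_factor Preconditioned = 6"

text \<open>
  A lower bound on the probability of recovery from a bucket that is not too noisy: the success probability 2/3 of
  Spot, and the product of 4/5 for the preconditioner and 3/4 for Spot.
\<close>

primrec bucket_success :: "version \<Rightarrow> real" where
  "bucket_success Basic = 2 / 3"
| "bucket_success Preconditioned = 3 / 5"

lemma C_const_eq: "C_const v p = bucket_factor v * noise_ratio v powr p"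
  by (cases v) (simp_all add: powr_powr flip: powr_half_sqrt)

lemma noise_ratio_pos: "noise_ratio v > 0"
  by (cases v) simp_all

lemma sets_run_spot:
  assumes "is_spot m \<delta> \<kappa> S spt" "J \<subseteq> {1..m}"
  shows "{\<omega> \<in> space S. j \<in> run m (spt J \<omega>) x} \<in> sets S"
proof -
  have "(\<lambda>\<omega>. run m (spt J \<omega>) x) \<in> measurable S (count_space UNIV)"
    using assms by (simp add: is_spot_def)
  from measurable_sets[OF this, of "{K. j \<in> K}"] show ?thesis
    by (simp add: vimage_def Int_def conj_commute)
qed

text \<open>
  With preconditioning the argument of Spot is random but takes finitely many values, so that the event
  is a finite union of rectangles.
\<close>

lemma sets_bucket_alg:
  assumes spot: "is_spot m \<delta> \<kappa> S spt" and J: "J \<subseteq> {1..m}"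
  shows "{\<rho> \<in> space (sign_space k m \<Otimes>\<^sub>M S). j \<in> run m (bucket_alg v spt J \<rho>) x} \<in> sets (sign_space k m \<Otimes>\<^sub>M S)"
proof (cases v)
  case Basic
  have "{\<rho> \<in> space (sign_space k m \<Otimes>\<^sub>M S). j \<in> run m (bucket_alg v spt J \<rho>) x} =
      space (sign_space k m) \<times> {\<omega> \<in> space S. j \<in> run m (spt J \<omega>) x}"
    using Basic by (auto simp: space_pair_measure)
  then show ?thesis
    using sets_run_spot[OF spot J] by (simp only: pair_measureI sets.top)
next
  case Preconditioned
  have "run m (precond 551 J a) x \<in> Pow J" for a
    by (auto simp: run_precond[OF J])
  then have "{\<rho> \<in> space (sign_space k m \<Otimes>\<^sub>M S). j \<in> run m (bucket_alg v spt J \<rho>) x} =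
      (\<Union>J'\<in>Pow J. {a \<in> space (sign_space k m). run m (precond 551 J a) x = J'} \<times>
        {\<omega> \<in> space S. j \<in> run m (spt J' \<omega>) x})"
    using Preconditioned by (auto simp: space_pair_measure simp del: space_sign_space)
  also have "\<dots> \<in> sets (sign_space k m \<Otimes>\<^sub>M S)"
    using J finite_subset[OF J]
    by (intro sets.finite_UN pair_measureI sets_run_spot[OF spot]) auto
  finally show ?thesis .
qed

lemma bucket_alg_recovers:
  assumes spot: "is_spot m (spot_delta v) \<kappa> S spt" and J: "J \<subseteq> {1..m}" "j \<in> J" and xj: "x j \<noteq> 0"
    and card: "real (card J) \<le> 2 powr (4 * (9/8) ^ \<kappa>)"
    and x: "(noise_ratio v)\<^sup>2 * (\<Sum>i\<in>J - {j}. (x i)\<^sup>2) \<le> (x j)\<^sup>2"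
  shows "measure (sign_space 551 m \<Otimes>\<^sub>M S)
      {\<rho> \<in> space (sign_space 551 m \<Otimes>\<^sub>M S). j \<in> run m (bucket_alg v spt J \<rho>) x} \<ge> bucket_success v"
proof -
  let ?A = "sign_space 551 m"
  let ?E = "{\<rho> \<in> space (?A \<Otimes>\<^sub>M S). j \<in> run m (bucket_alg v spt J \<rho>) x}"
  interpret A: prob_space ?A by (rule prob_space_sign_space)
  have S: "prob_space S" using spot by (simp add: is_spot_def)
  interpret S: prob_space S by (rule S)
  have fin: "finite J" using J finite_subset by blast
  have spot_ge: "1 - spot_delta v \<le> S.prob {\<omega> \<in> space S. j \<in> run m (spt J' \<omega>) x}"
    if J': "J' \<subseteq> J" "j \<in> J'"
      and small: "sqrt (\<Sum>i\<in>J' - {j}. (x i)\<^sup>2) \<le> spot_delta v * \<bar>x j\<bar> / (129 * sqrt (2 * ln (16 / spot_delta v)))" for J'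
  proof -
    have "card J' \<le> card J" using J' fin by (intro card_mono)
    then have "real (card J') \<le> 2 powr (4 * (9/8) ^ \<kappa>)" using card by linarith
    moreover have sub: "J' \<subseteq> {1..m}" using J J' by blast
    ultimately have "1 - spot_delta v \<le> S.prob {\<omega> \<in> space S. run m (spt J' \<omega>) x = {j}}"
      using spot J' xj small unfolding is_spot_def lp_norm_2 by blast
    also have "\<dots> \<le> S.prob {\<omega> \<in> space S. j \<in> run m (spt J' \<omega>) x}"
      by (intro S.finite_measure_mono sets_run_spot[OF spot sub]) auto
    finally show ?thesis .
  qed
  show ?thesis
  proof (cases v)
    case Basic
    let ?q = "387 * sqrt (2 * ln 48) :: real"
    have "sqrt (?q\<^sup>2 * (\<Sum>i\<in>J - {j}. (x i)\<^sup>2)) \<le> sqrt ((x j)\<^sup>2)"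
      using x Basic by (intro real_sqrt_le_mono) simp
    then have "?q * sqrt (\<Sum>i\<in>J - {j}. (x i)\<^sup>2) \<le> \<bar>x j\<bar>"
      by (simp only: real_sqrt_mult real_sqrt_abs abs_mult abs_of_nonneg real_sqrt_ge_zero) simp
    then have "sqrt (\<Sum>i\<in>J - {j}. (x i)\<^sup>2) \<le> spot_delta v * \<bar>x j\<bar> / (129 * sqrt (2 * ln (16 / spot_delta v)))"
      using Basic by (simp add: field_simps)
    from spot_ge[OF order.refl J(2) this]
    have "2 / 3 \<le> S.prob {\<omega> \<in> space S. j \<in> run m (spt J \<omega>) x}"
      using Basic by simp
    then have "A.prob (space ?A) * (2 / 3) \<le> measure (?A \<Otimes>\<^sub>M S) ?E"
      by (intro prob_pair_measure_ge[OF prob_space_sign_space S sets_bucket_alg[OF spot J(1)]])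
         (use Basic in \<open>auto simp: space_pair_measure\<close>)
    then show ?thesis
      using Basic A.prob_space by simp
  next
    case Preconditioned
    let ?G = "{a \<in> space ?A. j \<in> run m (precond 551 J a) x \<and>
      4000000 * (\<Sum>i\<in>run m (precond 551 J a) x - {j}. (x i)\<^sup>2) \<le> (x j)\<^sup>2}"
    have G: "4 / 5 \<le> A.prob ?G"
      using x Preconditioned by (intro prob_precond_isolates J xj) simp
    have "3 / 4 \<le> S.prob {\<omega> \<in> space S. (a, \<omega>) \<in> ?E}" if a: "a \<in> ?G" for a
    proof -
      let ?J' = "run m (precond 551 J a) x"
      have sub: "?J' \<subseteq> J" by (auto simp: run_precond[OF J(1)])
      \<comment> \<open>The demand of Spot for \<open>\<delta> = 1/4\<close> is a ratio of \<open>516 * sqrt (2 * ln 64)\<close>.\<close>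
      have "ln 64 = 6 * ln (2 :: real)"
        using ln_realpow[of "2 :: real" 6] by simp
      then have "2 * ln 64 < (12 :: real)"
        using ln_2_less_1 by simp
      then have "sqrt (2 * ln 64) \<le> (sqrt 12 :: real)"
        by (intro real_sqrt_le_mono) simp
      also have "\<dots> \<le> 3.5"
        by (rule real_le_lsqrt) (simp_all add: power2_eq_square)
      finally have l: "516 * sqrt (2 * ln 64) \<le> (2000 :: real)" by simp
      have pos: "0 < sqrt (2 * ln 64 :: real)" by simp
      have "sqrt (2000\<^sup>2 * (\<Sum>i\<in>?J' - {j}. (x i)\<^sup>2)) \<le> sqrt ((x j)\<^sup>2)"
        using a by (intro real_sqrt_le_mono) simp
      then have small: "2000 * sqrt (\<Sum>i\<in>?J' - {j}. (x i)\<^sup>2) \<le> \<bar>x j\<bar>"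
        by (simp add: real_sqrt_mult)
      have "sqrt (\<Sum>i\<in>?J' - {j}. (x i)\<^sup>2) * (516 * sqrt (2 * ln 64)) \<le> \<bar>x j\<bar>"
      proof -
        have "sqrt (\<Sum>i\<in>?J' - {j}. (x i)\<^sup>2) * (516 * sqrt (2 * ln 64))
            \<le> sqrt (\<Sum>i\<in>?J' - {j}. (x i)\<^sup>2) * 2000"
          by (intro mult_left_mono l) (simp add: sum_nonneg)
        with small show ?thesis by linarith
      qed
      then have "sqrt (\<Sum>i\<in>?J' - {j}. (x i)\<^sup>2) \<le> spot_delta v * \<bar>x j\<bar> / (129 * sqrt (2 * ln (16 / spot_delta v)))"
        using Preconditioned pos by (simp add: field_simps)
      from spot_ge[OF sub _ this]
      have "3 / 4 \<le> S.prob {\<omega> \<in> space S. j \<in> run m (spt ?J' \<omega>) x}"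
        using a Preconditioned by simp
      also have "{\<omega> \<in> space S. j \<in> run m (spt ?J' \<omega>) x} = {\<omega> \<in> space S. (a, \<omega>) \<in> ?E}"
        using a Preconditioned by (auto simp: space_pair_measure)
      finally show ?thesis .
    qed
    then have "A.prob ?G * (3 / 4) \<le> measure (?A \<Otimes>\<^sub>M S) ?E"
      by (intro prob_pair_measure_ge[OF prob_space_sign_space S sets_bucket_alg[OF spot J(1)]]) auto
    then show ?thesis
      using Preconditioned G by simp
  qed
qed

section \<open>Detection by one execution of Discover\<close>

lemma bucket_subset: "bucket m D \<pi> d \<subseteq> {1..m}"
  by (auto simp: bucket_def)

text \<open>
  The iteration depth is the least natural number that makes the capacity of Spot reach the maximal
  bucket size.
\<close>

lemma card_bucket_le_spot_capacity:
  assumes "\<pi> permutes {1..m}" "m \<ge> 1" "D \<ge> 1"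
  shows "real (card (bucket m D \<pi> d)) \<le> 2 powr (4 * (9/8) ^ k_star m D)"
proof -
  let ?n = "\<lceil>real m / real D\<rceil>"
  have "0 < real m / real D" using assms by simp
  then have n: "?n \<ge> 1" by linarith
  have "of_int ?n \<le> (2::real) powr (4 * (9/8) ^ k_star m D)"
  proof (cases "?n = 1")
    case True
    then show ?thesis by (simp add: k_star_def)
  next
    case False
    with n have n2: "?n \<ge> 2" by linarith
    let ?t = "log 2 (of_int ?n) / 4"
    have "log 2 2 \<le> log 2 (of_int ?n :: real)"
      using n2 by (subst log_le_cancel_iff) auto
    then have t: "?t > 0" by simp
    have "log (9/8) ?t \<le> real (k_star m D)"
      using False by (simp add: k_star_def) linarith
    then have "(9/8) powr (log (9/8) ?t) \<le> (9/8) powr real (k_star m D)"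
      by (intro powr_mono) auto
    then have "?t \<le> (9/8) ^ k_star m D"
      using t by (simp add: powr_realpow)
    then have "log 2 (of_int ?n) \<le> 4 * (9/8) ^ k_star m D" by simp
    then show ?thesis
      using n by (subst (asm) log_le_iff) auto
  qed
  then show ?thesis
    using card_bucket_le[OF assms, of d] by linarith
qed

text \<open>
  The \<open>\<ell>\<^sub>2\<close>-norm is at most the \<open>\<ell>\<^sub>t\<close>-norm: after division by \<open>c\<close> every entry is at most 1, so that
  squaring makes it smaller than taking the power \<open>t\<close>.
\<close>

lemma sum_squares_le_of_sum_powr:
  fixes x :: "nat \<Rightarrow> real"
  assumes fin: "finite I" and t: "0 < t" "t \<le> 2" and c: "c > 0"
    and le: "(\<Sum>i\<in>I. \<bar>x i\<bar> powr t) \<le> c powr t"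
  shows "(\<Sum>i\<in>I. (x i)\<^sup>2) \<le> c\<^sup>2"
proof -
  have summand: "(\<bar>x i\<bar> / c)\<^sup>2 \<le> (\<bar>x i\<bar> / c) powr t" if i: "i \<in> I" for i
  proof -
    have "\<bar>x i\<bar> powr t \<le> (\<Sum>i\<in>I. \<bar>x i\<bar> powr t)"
      using fin i by (intro member_le_sum) auto
    also note le
    finally have "\<bar>x i\<bar> \<le> c"
      using t c by (metis abs_ge_zero less_imp_le powr_less_mono2 not_le)
    then have "\<bar>x i\<bar> / c \<le> 1" using c by simp
    then have "(\<bar>x i\<bar> / c) powr 2 \<le> (\<bar>x i\<bar> / c) powr t"
      using t c by (intro powr_mono') auto
    then show ?thesis
      using c by (simp add: powr_numeral)
  qed
  have "(\<Sum>i\<in>I. (x i)\<^sup>2) / c\<^sup>2 = (\<Sum>i\<in>I. (\<bar>x i\<bar> / c)\<^sup>2)"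
    by (simp add: sum_divide_distrib power_divide)
  also have "\<dots> \<le> (\<Sum>i\<in>I. (\<bar>x i\<bar> / c) powr t)"
    by (intro sum_mono summand)
  also have "\<dots> = (\<Sum>i\<in>I. \<bar>x i\<bar> powr t) / c powr t"
    using c by (simp add: powr_divide sum_divide_distrib)
  also have "\<dots> \<le> 1"
    using le c by simp
  finally show ?thesis
    using c by simp
qed

lemma prob_space_discover_space:
  assumes "is_spot_family m S spot"
  shows "prob_space (discover_space m v S D)"
    and "prob_space (sign_space 551 m \<Otimes>\<^sub>M S (spot_delta v) (k_star m D))"
    and "prob_space (PiM {1..D} (\<lambda>_. sign_space 551 m \<Otimes>\<^sub>M S (spot_delta v) (k_star m D)))"
proof -
  have S: "prob_space (S (spot_delta v) (k_star m D))"
    using assms spot_delta_bounds by (simp add: is_spot_family_def is_spot_def)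
  show rho: "prob_space (sign_space 551 m \<Otimes>\<^sub>M S (spot_delta v) (k_star m D))"
    using S by (intro prob_space_pair_measure prob_space_sign_space)
  then show pi: "prob_space (PiM {1..D} (\<lambda>_. sign_space 551 m \<Otimes>\<^sub>M S (spot_delta v) (k_star m D)))"
    by (intro prob_space_PiM)
  show "prob_space (discover_space m v S D)"
    unfolding discover_space_def by (intro prob_space_pair_measure prob_space_perm_space pi)
qed

lemma run_discover:
  "run m (discover m v spot D \<omega>) x = (\<Union>d\<in>{1..D}. run m (bucket_alg v
     (spot (spot_delta v) (k_star m D)) (bucket m D (fst \<omega>) d) (snd \<omega> d)) x)"
  unfolding discover_def by (simp add: atLeastLessThanSuc_atLeastAtMost del: upt_Suc)

text \<open>
  There are finitely many permutations, and for each of them finitely many buckets; the random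
  elements of Spot enter through one component each.
\<close>

lemma sets_discover:
  assumes fam: "is_spot_family m S spot"
  shows "{\<omega> \<in> space (discover_space m v S D). j \<in> run m (discover m v spot D \<omega>) x}
    \<in> sets (discover_space m v S D)"
proof -
  let ?spt = "spot (spot_delta v) (k_star m D)"
  define R where "R = sign_space 551 m \<Otimes>\<^sub>M S (spot_delta v) (k_star m D)"
  define E where "E = (\<lambda>\<pi> d. {\<rho> \<in> space R. j \<in> run m (bucket_alg v ?spt (bucket m D \<pi> d) \<rho>) x})"
  let ?Q = "PiM {1..D} (\<lambda>_. R)"
  have spot: "is_spot m (spot_delta v) (k_star m D) (S (spot_delta v) (k_star m D)) ?spt"
    using fam spot_delta_bounds by (simp add: is_spot_family_def)
  have space: "discover_space m v S D = perm_space m \<Otimes>\<^sub>M ?Q"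
    by (simp add: discover_space_def R_def)
  have E: "E \<pi> d \<in> sets R" for \<pi> d
    unfolding E_def R_def by (rule sets_bucket_alg[OF spot bucket_subset])
  have mem: "\<rho> d \<in> space R" if "\<rho> \<in> space ?Q" "d \<in> {1..D}" for \<rho> d
    using that by (auto simp: space_PiM)
  have "{\<omega> \<in> space (discover_space m v S D). j \<in> run m (discover m v spot D \<omega>) x} =
    (\<Union>\<pi>\<in>{\<pi>. \<pi> permutes {1..m}}. {\<pi>} \<times> (\<Union>d\<in>{1..D}. {\<rho> \<in> space ?Q. \<rho> d \<in> E \<pi> d}))"
    unfolding space space_pair_measure space_perm_space run_discover E_def
    using mem by (auto simp del: atLeastAtMost_iff)
  also have "\<dots> \<in> sets (discover_space m v S D)"
    unfolding space
  proof (intro sets.finite_UN finite_perms pair_measureI finite_atLeastAtMost)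
    fix \<pi> d assume d: "d \<in> {1..D}"
    have "(\<lambda>\<rho>. \<rho> d) -` E \<pi> d \<inter> space ?Q \<in> sets ?Q"
      using d E by (intro measurable_sets[OF measurable_component_singleton])
    also have "(\<lambda>\<rho>. \<rho> d) -` E \<pi> d \<inter> space ?Q = {\<rho> \<in> space ?Q. \<rho> d \<in> E \<pi> d}"
      by auto
    finally show "{\<rho> \<in> space ?Q. \<rho> d \<in> E \<pi> d} \<in> sets ?Q" .
  qed auto
  finally show ?thesis .
qed

text \<open>
  The hashing succeeds with probability \<open>1 - 1 / bucket_factor v\<close> by Markov's inequality, and given a
  good permutation the bucket of \<open>j\<close> reveals \<open>j\<close> with probability \<open>bucket_success v\<close>. In both versions the
  product is 1/2: \<open>3/4 * 2/3\<close> and \<open>5/6 * 3/5\<close>.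
\<close>

lemma discover_detects:
  assumes fam: "is_spot_family m S spot" and D: "D \<ge> 1" and t: "0 < t" "t \<le> 2"
    and j: "j \<in> {1..m}" and xj: "x j \<noteq> 0"
    and large: "C_const v t * (\<Sum>i=1..m. \<bar>x i\<bar> powr t) \<le> real D * \<bar>x j\<bar> powr t"
  shows "measure (discover_space m v S D)
    {\<omega> \<in> space (discover_space m v S D). j \<in> run m (discover m v spot D \<omega>) x} \<ge> 1 / 2"
proof -
  let ?spt = "spot (spot_delta v) (k_star m D)"
  let ?R = "sign_space 551 m \<Otimes>\<^sub>M S (spot_delta v) (k_star m D)"
  let ?E = "{\<omega> \<in> space (discover_space m v S D). j \<in> run m (discover m v spot D \<omega>) x}"
  have spot: "is_spot m (spot_delta v) (k_star m D) (S (spot_delta v) (k_star m D)) ?spt"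
    using fam spot_delta_bounds by (simp add: is_spot_family_def)
  interpret P: prob_space "perm_space m" by (rule prob_space_perm_space)
  interpret Q: prob_space "PiM {1..D} (\<lambda>_. ?R)" by (rule prob_space_discover_space[OF fam])
  interpret R: prob_space ?R by (rule prob_space_discover_space[OF fam])
  have m: "m \<ge> 1" using j by simp
  define c where "c = \<bar>x j\<bar> / noise_ratio v"
  have c: "c > 0" using xj noise_ratio_pos by (simp add: c_def)
  let ?B = "\<lambda>\<pi>. bucket m D \<pi> (equi_hash m D \<pi> j)"
  define Bad where "Bad = {\<pi>. \<pi> permutes {1..m} \<and> c powr t \<le> (\<Sum>i\<in>?B \<pi> - {j}. \<bar>x i\<bar> powr t)}"
  let ?G = "space (perm_space m) - Bad"
  have g: "bucket_factor v > 0" by (cases v) auto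
  have "P.prob Bad \<le> (\<Sum>i=1..m. \<bar>x i\<bar> powr t) / (real D * c powr t)"
    unfolding Bad_def using j D c by (intro prob_bucket_sum_ge) auto
  also have "\<dots> = noise_ratio v powr t * (\<Sum>i=1..m. \<bar>x i\<bar> powr t) / (real D * \<bar>x j\<bar> powr t)"
    using noise_ratio_pos[of v] by (simp add: c_def powr_divide)
  also have "\<dots> \<le> 1 / bucket_factor v"
    using large D xj g unfolding C_const_eq by (simp add: field_simps)
  finally have "1 - 1 / bucket_factor v \<le> 1 - P.prob Bad" by simp
  also have "\<dots> = P.prob ?G"
    by (intro P.prob_compl[symmetric]) (auto simp: Bad_def)
  finally have G: "1 - 1 / bucket_factor v \<le> P.prob ?G" .
  have "bucket_success v \<le> Q.prob {\<rho> \<in> space (PiM {1..D} (\<lambda>_. ?R)). (\<pi>, \<rho>) \<in> ?E}" if \<pi>: "\<pi> \<in> ?G" for \<pi>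
  proof -
    let ?d = "equi_hash m D \<pi> j"
    let ?F = "{\<rho> \<in> space ?R. j \<in> run m (bucket_alg v ?spt (?B \<pi>) \<rho>) x}"
    have perm: "\<pi> permutes {1..m}" and sum: "(\<Sum>i\<in>?B \<pi> - {j}. \<bar>x i\<bar> powr t) < c powr t"
      using \<pi> by (auto simp: Bad_def)
    have d: "?d \<in> {1..D}" by (rule equi_hash_in_range[OF perm j D])
    have fin: "finite (?B \<pi> - {j})" using finite_subset[OF bucket_subset] by blast
    have "(\<Sum>i\<in>?B \<pi> - {j}. (x i)\<^sup>2) \<le> c\<^sup>2"
      using sum by (intro sum_squares_le_of_sum_powr[OF fin t c]) simp
    then have "(noise_ratio v)\<^sup>2 * (\<Sum>i\<in>?B \<pi> - {j}. (x i)\<^sup>2) \<le> (x j)\<^sup>2"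
      using noise_ratio_pos[of v] by (simp add: c_def power_divide field_simps)
    then have "bucket_success v \<le> R.prob ?F"
      using j xj bucket_subset
      by (intro bucket_alg_recovers[OF spot] card_bucket_le_spot_capacity[OF perm m D]) (simp_all add: bucket_def)
    also have "\<dots> = Q.prob {\<rho> \<in> space (PiM {1..D} (\<lambda>_. ?R)). \<rho> ?d \<in> ?F}"
      using d prob_space_discover_space(2)[OF fam] sets_bucket_alg[OF spot bucket_subset]
      by (intro prob_component[symmetric]) auto
    also have "\<dots> \<le> Q.prob {\<rho> \<in> space (PiM {1..D} (\<lambda>_. ?R)). (\<pi>, \<rho>) \<in> ?E}"
    proof (rule Q.finite_measure_mono)
      show "{\<rho> \<in> space (PiM {1..D} (\<lambda>_. ?R)). \<rho> ?d \<in> ?F} \<subseteq> {\<rho> \<in> space (PiM {1..D} (\<lambda>_. ?R)). (\<pi>, \<rho>) \<in> ?E}"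
        using d perm by (auto simp: discover_space_def space_pair_measure run_discover simp del: One_nat_def)
      have "Pair \<pi> -` ?E \<in> sets (PiM {1..D} (\<lambda>_. ?R))"
        using sets_discover[OF fam] unfolding discover_space_def by (rule sets_Pair1)
      moreover have "Pair \<pi> -` ?E = {\<rho> \<in> space (PiM {1..D} (\<lambda>_. ?R)). (\<pi>, \<rho>) \<in> ?E}"
        by (auto simp: discover_space_def space_pair_measure)
      ultimately show "{\<rho> \<in> space (PiM {1..D} (\<lambda>_. ?R)). (\<pi>, \<rho>) \<in> ?E} \<in> sets (PiM {1..D} (\<lambda>_. ?R))"
        by simp
    qed
    finally show ?thesis .
  qed
  moreover have "?E \<in> sets (perm_space m \<Otimes>\<^sub>M PiM {1..D} (\<lambda>_. ?R))"
    using sets_discover[OF fam] unfolding discover_space_def .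
  ultimately have "P.prob ?G * bucket_success v \<le> measure (perm_space m \<Otimes>\<^sub>M PiM {1..D} (\<lambda>_. ?R)) ?E"
    by (intro prob_pair_measure_ge prob_space_perm_space prob_space_discover_space[OF fam])
       (cases v; auto)+
  moreover have "1 / 2 \<le> (1 - 1 / bucket_factor v) * bucket_success v"
    by (cases v) simp_all
  moreover have "(1 - 1 / bucket_factor v) * bucket_success v \<le> P.prob ?G * bucket_success v"
    using G by (intro mult_right_mono) (cases v; simp)+
  ultimately show ?thesis
    unfolding discover_space_def by linarith
qed

section \<open>Detection levels and the error of one coordinate\<close>

text \<open>
  Young's inequality with exponents \<open>t / p\<close> and \<open>1 - t / p\<close>, applied to \<open>m \<bar>x i\<bar> powr p\<close> and 1 and summed
  over \<open>i\<close>, replaces Hoelder's inequality. For \<open>t = p\<close> the right-hand side is 1, which allows to treat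
  \<open>p \<le> 2\<close> and \<open>p > 2\<close> together with \<open>t = min 2 p\<close>.
\<close>

lemma sum_powr_embedding:
  fixes x :: "nat \<Rightarrow> real"
  assumes t: "0 < t" "t \<le> p" and m: "m \<ge> 1" and x: "(\<Sum>i=1..m. \<bar>x i\<bar> powr p) \<le> 1"
  shows "(\<Sum>i=1..m. \<bar>x i\<bar> powr t) \<le> real m powr (1 - t / p)"
proof -
  have p: "p > 0" using t by simp
  have young: "real m powr (t / p) * \<bar>x i\<bar> powr t \<le> t / p * (real m * \<bar>x i\<bar> powr p) + (1 - t / p)" for i
  proof (cases "x i = 0")
    case True
    then show ?thesis using t p by simp
  next
    case False
    have "(real m * \<bar>x i\<bar> powr p) powr (t / p) * 1 powr (1 - t / p)
        \<le> t / p * (real m * \<bar>x i\<bar> powr p) + (1 - t / p) * 1"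
      using t p m False by (intro Youngs_inequality_0) auto
    then show ?thesis
      using p by (simp add: powr_mult powr_powr)
  qed
  have "real m powr (t / p) * (\<Sum>i=1..m. \<bar>x i\<bar> powr t)
      \<le> (\<Sum>i=1..m. t / p * (real m * \<bar>x i\<bar> powr p) + (1 - t / p))"
    unfolding sum_distrib_left by (intro sum_mono young)
  also have "\<dots> = t / p * real m * (\<Sum>i=1..m. \<bar>x i\<bar> powr p) + real m * (1 - t / p)"
    by (simp add: sum.distrib sum_distrib_left mult.assoc)
  also have "\<dots> \<le> t / p * real m * 1 + real m * (1 - t / p)"
    using x t p by (intro add_right_mono mult_left_mono) auto
  also have "\<dots> = real m powr (t / p) * real m powr (1 - t / p)"
    using m by (simp add: algebra_simps flip: powr_add)
  finally show ?thesis
    using m by simp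
qed

lemma num_buckets_ge:
  assumes "p > 0" "m \<ge> 1"
  shows "C_const v (min 2 p) * real m powr (1 - min 2 p / p) * 2 ^ l \<le> real (num_buckets m p v l)"
  using assms unfolding num_buckets_def by (cases "p \<le> 2") (auto simp: min_def intro: order.trans[OF _ real_nat_ceiling_ge])

lemma C_const_ge: "C_const v p \<ge> 4" if "p \<ge> 0"
proof -
  have "noise_ratio v \<ge> 1"
  proof (cases v)
    case Basic
    have "ln 2 \<le> ln (48 :: real)" by simp
    then have "1 \<le> 2 * ln (48 :: real)" using ln2_ge_two_thirds by linarith
    then have "1 \<le> sqrt (2 * ln 48 :: real)" by simp
    then show ?thesis unfolding Basic noise_ratio.simps by linarith
  qed simp
  then have "noise_ratio v powr p \<ge> 1"
    using that by (rule ge_one_powr_ge_zero)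
  moreover have "bucket_factor v \<ge> 4" by (cases v) auto
  ultimately have "4 * 1 \<le> bucket_factor v * noise_ratio v powr p"
    by (intro mult_mono) auto
  then show ?thesis by (simp add: C_const_eq)
qed

lemma num_buckets_pos:
  assumes "p > 0" "m \<ge> 1"
  shows "num_buckets m p v l \<ge> 1"
proof -
  have "0 < C_const v (min 2 p) * real m powr (1 - min 2 p / p) * 2 ^ l"
    using assms C_const_ge[of "min 2 p" v] by (intro mult_pos_pos) auto
  then show ?thesis using num_buckets_ge[OF assms, of v l] by linarith
qed

text \<open>
  A coordinate with \<open>\<bar>x j\<bar> powr t \<ge> 1 / 2 ^ l\<close> is large enough for the number of buckets on level \<open>l\<close>.
\<close>

lemma level_detects:
  assumes fam: "is_spot_family m S spot" and p: "p > 0" and j: "j \<in> {1..m}"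
    and x: "(\<Sum>i=1..m. \<bar>x i\<bar> powr p) \<le> 1"
    and large: "1 \<le> 2 ^ l * \<bar>x j\<bar> powr (min 2 p)"
  shows "measure (discover_space m v S (num_buckets m p v l))
    {\<omega> \<in> space (discover_space m v S (num_buckets m p v l)).
      j \<in> run m (discover m v spot (num_buckets m p v l) \<omega>) x} \<ge> 1 / 2"
proof (rule discover_detects[OF fam])
  let ?D = "num_buckets m p v l"
  let ?t = "min 2 p"
  have m: "m \<ge> 1" using j by simp
  show "?D \<ge> 1" by (rule num_buckets_pos[OF p m])
  show "0 < ?t" "?t \<le> 2" "j \<in> {1..m}" using p j by auto
  show "x j \<noteq> 0" using large by auto
  have C: "C_const v ?t \<ge> 0" using C_const_ge[of ?t v] p by simp
  have "C_const v ?t * (\<Sum>i=1..m. \<bar>x i\<bar> powr ?t) \<le> C_const v ?t * real m powr (1 - ?t / p) * 1"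
    using sum_powr_embedding[OF _ _ m x, of ?t] p C by (simp add: mult_left_mono)
  also have "\<dots> \<le> C_const v ?t * real m powr (1 - ?t / p) * (2 ^ l * \<bar>x j\<bar> powr ?t)"
    using large C by (intro mult_left_mono) auto
  also have "\<dots> = C_const v ?t * real m powr (1 - ?t / p) * 2 ^ l * \<bar>x j\<bar> powr ?t"
    by simp
  also have "\<dots> \<le> real ?D * \<bar>x j\<bar> powr ?t"
    by (intro mult_right_mono num_buckets_ge[OF p m]) auto
  finally show "C_const v ?t * (\<Sum>i=1..m. \<bar>x i\<bar> powr ?t) \<le> real ?D * \<bar>x j\<bar> powr ?t" .
qed

text \<open>
  Here \<open>w\<close> is \<open>\<bar>x j\<bar> powr t\<close> and \<open>P l\<close> the detection probability on level \<open>l\<close>. In the induction on \<open>L\<close>,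
  either the new level at least halves the product or \<open>w\<close> alone is already smaller than the bound; so the level
  at which detection sets in never has to be named.
\<close>

lemma weight_times_miss_le:
  fixes P :: "nat \<Rightarrow> real"
  assumes w: "0 \<le> w" "w \<le> 1" and P: "\<And>l. 0 \<le> P l" "\<And>l. P l \<le> 1"
    and detect: "\<And>l. 1 \<le> 2 ^ l * w \<Longrightarrow> 1 / 2 \<le> P l"
  shows "w * (\<Prod>l=1..L. 1 - P l) \<le> 1 / 2 ^ L"
proof (induction L)
  case 0
  then show ?case using w by simp
next
  case (Suc L)
  have prod: "0 \<le> (\<Prod>l=1..L. 1 - P l)" "(\<Prod>l=1..L. 1 - P l) \<le> 1"
    using P by (auto intro: prod_nonneg prod_le_1)
  show ?case
  proof (cases "1 \<le> 2 ^ Suc L * w")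
    case True
    have "w * (\<Prod>l=1..L. 1 - P l) * (1 - P (Suc L)) \<le> 1 / 2 ^ L * (1 / 2)"
      using Suc detect[OF True] P by (intro mult_mono) auto
    then show ?thesis by (simp add: mult.assoc)
  next
    case False
    have "w * ((\<Prod>l=1..L. 1 - P l) * (1 - P (Suc L))) \<le> w * 1"
      using w prod P by (intro mult_left_mono mult_le_one) auto
    also have "\<dots> \<le> 1 / 2 ^ Suc L"
      using False by (simp add: field_simps)
    finally show ?thesis by simp
  qed
qed

text \<open>
  The power \<open>(q - p) / t\<close> of the preceding estimate: it turns \<open>y powr t\<close> into \<open>y powr (q - p)\<close>, and
  the \<open>R\<close> repetitions, at least \<open>(q - p) / t\<close> in number, supply the power of the product.
\<close>

lemma coordinate_error_le:
  fixes P :: "nat \<Rightarrow> real"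
  assumes t: "0 < t" and pq: "0 < p" "p < q" and R: "(q - p) / t \<le> real R"
    and y: "0 \<le> y" "y \<le> 1" and P: "\<And>l. 0 \<le> P l" "\<And>l. P l \<le> 1"
    and detect: "\<And>l. 1 \<le> 2 ^ l * y powr t \<Longrightarrow> 1 / 2 \<le> P l"
  shows "y powr q * (\<Prod>(r, l)\<in>{1..R} \<times> {1..L}. 1 - P l) \<le> y powr p * 2 powr (- ((q - p) / t) * real L)"
proof -
  let ?b = "(q - p) / t"
  define miss where "miss = (\<Prod>l=1..L. 1 - P l)"
  have b: "?b > 0" using t pq by simp
  have miss: "0 \<le> miss" "miss \<le> 1"
    unfolding miss_def using P by (auto intro: prod_nonneg prod_le_1)
  have w: "0 \<le> y powr t" "y powr t \<le> 1"
    using y t by (auto intro: powr_le1)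
  have "(\<Prod>(r, l)\<in>{1..R} \<times> {1..L}. 1 - P l) = miss ^ R"
    by (simp add: miss_def flip: prod.cartesian_product)
  also have "\<dots> \<le> miss powr ?b"
  proof (cases "miss = 0")
    case True
    then show ?thesis using R b by (cases R) auto
  next
    case False
    then have "miss ^ R = miss powr real R" using miss by (simp add: powr_realpow)
    also have "\<dots> \<le> miss powr ?b" using miss R by (intro powr_mono') auto
    finally show ?thesis .
  qed
  finally have "y powr q * (\<Prod>(r, l)\<in>{1..R} \<times> {1..L}. 1 - P l) \<le> y powr q * miss powr ?b"
    by (intro mult_left_mono) auto
  also have "\<dots> = y powr p * (y powr t * miss) powr ?b"
  proof -
    have "y powr q = y powr p * (y powr t) powr ?b"
      using t by (simp add: powr_powr flip: powr_add)
    then show ?thesis using w miss by (simp add: powr_mult)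
  qed
  also have "\<dots> \<le> y powr p * (1 / 2 ^ L) powr ?b"
    using weight_times_miss_le[of "y powr t" P L, OF w P detect] w miss b
    unfolding miss_def by (intro mult_left_mono powr_mono2) auto
  also have "(1 / 2 ^ L) powr ?b = 2 powr (- ?b * real L)"
    by (simp add: powr_powr powr_minus_divide powr_divide mult.commute flip: powr_realpow)
  finally show ?thesis .
qed

section \<open>Expected error of the multi-sensitivity algorithm\<close>

lemma bucket_alg_bounds:
  assumes spot: "is_spot m \<delta> \<kappa> S spt" and J: "J \<subseteq> {1..m}" and \<rho>: "snd \<rho> \<in> space S"
  shows "run m (bucket_alg v spt J \<rho>) x \<subseteq> J"
    and "card (run m (bucket_alg v spt J \<rho>) x) \<le> 1"
    and "num_queries m (bucket_alg v spt J \<rho>) x \<le> 551 + 2 * (\<kappa> + 1)"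
proof -
  have *: "num_queries m (spt J' (snd \<rho>)) x \<le> 2 * (\<kappa> + 1)" "run m (spt J' (snd \<rho>)) x \<subseteq> J'"
    "card (run m (spt J' (snd \<rho>)) x) \<le> 1" if "J' \<subseteq> {1..m}" for J'
    using spot \<rho> that unfolding is_spot_def by blast+
  let ?J' = "run m (precond 551 J (fst \<rho>)) x"
  have sub: "?J' \<subseteq> J" by (auto simp: run_precond[OF J])
  then have sub': "?J' \<subseteq> {1..m}" using J by blast
  show "run m (bucket_alg v spt J \<rho>) x \<subseteq> J" "card (run m (bucket_alg v spt J \<rho>) x) \<le> 1"
    "num_queries m (bucket_alg v spt J \<rho>) x \<le> 551 + 2 * (\<kappa> + 1)"
    using *[OF J] *[OF sub'] sub by (cases v; auto)+
qed

lemma discover_bounds: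
  assumes fam: "is_spot_family m S spot" and \<omega>: "\<omega> \<in> space (discover_space m v S D)"
  shows "run m (discover m v spot D \<omega>) x \<subseteq> {1..m}"
    and "card (run m (discover m v spot D \<omega>) x) \<le> D"
    and "num_queries m (discover m v spot D \<omega>) x \<le> D * (551 + 2 * (k_star m D + 1))"
proof -
  let ?spt = "spot (spot_delta v) (k_star m D)"
  let ?B = "\<lambda>d. bucket_alg v ?spt (bucket m D (fst \<omega>) d) (snd \<omega> d)"
  have spot: "is_spot m (spot_delta v) (k_star m D) (S (spot_delta v) (k_star m D)) ?spt"
    using fam spot_delta_bounds by (simp add: is_spot_family_def)
  have \<rho>: "snd (snd \<omega> d) \<in> space (S (spot_delta v) (k_star m D))" if "d \<in> {1..D}" for d
  proof -
    have "snd \<omega> d \<in> space (sign_space 551 m \<Otimes>\<^sub>M S (spot_delta v) (k_star m D))"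
    proof (rule PiE_mem[OF _ that])
      show "snd \<omega> \<in> (\<Pi>\<^sub>E d\<in>{1..D}. space (sign_space 551 m \<Otimes>\<^sub>M S (spot_delta v) (k_star m D)))"
        using \<omega> by (auto simp: discover_space_def space_pair_measure[of "perm_space m"] space_PiM)
    qed
    then show ?thesis by (auto simp: space_pair_measure)
  qed
  note B = bucket_alg_bounds[OF spot bucket_subset \<rho>]
  show "run m (discover m v spot D \<omega>) x \<subseteq> {1..m}"
    unfolding run_discover using B(1) bucket_subset by (intro UN_least) (blast intro: order.trans)
  have "card (run m (discover m v spot D \<omega>) x) \<le> (\<Sum>d=1..D. card (run m (?B d) x))"
    unfolding run_discover by (rule card_UN_le) simp
  also have "\<dots> \<le> (\<Sum>d=1..D. 1)"
    by (intro sum_mono B(2))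
  finally show "card (run m (discover m v spot D \<omega>) x) \<le> D" by simp
  have "num_queries m (discover m v spot D \<omega>) x = (\<Sum>d=1..D. num_queries m (?B d) x)"
    unfolding discover_def num_queries_union_alg
    by (simp add: interv_sum_list_conv_sum_set_nat atLeastLessThanSuc_atLeastAtMost del: upt_Suc)
  also have "\<dots> \<le> (\<Sum>d=1..D. 551 + 2 * (k_star m D + 1))"
    by (intro sum_mono B(3))
  finally show "num_queries m (discover m v spot D \<omega>) x \<le> D * (551 + 2 * (k_star m D + 1))"
    by simp
qed

definition candidates ::
  "nat \<Rightarrow> real \<Rightarrow> version \<Rightarrow> (real \<Rightarrow> nat \<Rightarrow> nat set \<Rightarrow> 'w \<Rightarrow> nat set meas_alg) \<Rightarrow> nat \<Rightarrow> nat
    \<Rightarrow> (nat \<times> nat \<Rightarrow> 'w discover_input) \<Rightarrow> (nat \<Rightarrow> real) \<Rightarrow> nat set" where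
  "candidates m p v spot L R \<omega> x =
    (\<Union>(r, l)\<in>{1..R} \<times> {1..L}. run m (discover m v spot (num_buckets m p v l) (\<omega> (r, l))) x)"

lemma run_candidates_alg:
  "run m (union_alg (List.product [1..<Suc R] [1..<Suc L])
     (\<lambda>(r, l). discover m v spot (num_buckets m p v l) (\<omega> (r, l)))) x = candidates m p v spot L R \<omega> x"
  by (auto simp: candidates_def atLeastLessThanSuc_atLeastAtMost simp del: upt_Suc)

lemma space_multi_space:
  assumes "\<omega> \<in> space (multi_space m p v S L R)" "r \<in> {1..R}" "l \<in> {1..L}"
  shows "\<omega> (r, l) \<in> space (discover_space m v S (num_buckets m p v l))"
proof -
  have "(r, l) \<in> {1..R} \<times> {1..L}" using assms by blast
  with assms(1) show ?thesis
    unfolding multi_space_def space_PiM by (drule_tac PiE_mem) auto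
qed

lemma candidates_subset:
  assumes "is_spot_family m S spot" "\<omega> \<in> space (multi_space m p v S L R)"
  shows "candidates m p v spot L R \<omega> x \<subseteq> {1..m}"
  unfolding candidates_def
  using discover_bounds(1)[OF assms(1) space_multi_space[OF assms(2)]] by (intro UN_least) fast

lemma run_multi_alg:
  assumes fam: "is_spot_family m S spot" and \<omega>: "\<omega> \<in> space (multi_space m p v S L R)" and j: "j \<in> {1..m}"
  shows "run m (multi_alg m p v spot L R \<omega>) x j = (if j \<in> candidates m p v spot L R \<omega> x then x j else 0)"
proof -
  have "finite (candidates m p v spot L R \<omega> x)"
    using candidates_subset[OF fam \<omega>] finite_subset by blast
  moreover have "(\<Sum>i=1..m. (if i = j then 1 else 0) * x i) = x j"
    using j by (simp add: if_distrib[of "\<lambda>y. y * _"] sum.delta cong: if_cong)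
  ultimately show ?thesis
    unfolding multi_alg_def run_then_alg run_candidates_alg run_query_all by simp
qed

text \<open>
  Missing \<open>j\<close> is a box in the product of the independent executions, so its probability factorises.
\<close>

lemma multi_miss:
  fixes x :: "nat \<Rightarrow> real" and p :: real and v :: version and L R j :: nat
  assumes fam: "is_spot_family m S spot"
  defines "P \<equiv> \<lambda>j l. measure (discover_space m v S (num_buckets m p v l))
    {\<omega> \<in> space (discover_space m v S (num_buckets m p v l)).
      j \<in> run m (discover m v spot (num_buckets m p v l) \<omega>) x}"
  defines "Miss \<equiv> \<lambda>j. {\<omega> \<in> space (multi_space m p v S L R). j \<notin> candidates m p v spot L R \<omega> x}"
  shows "Miss j \<in> sets (multi_space m p v S L R)"
    and "measure (multi_space m p v S L R) (Miss j) = (\<Prod>(r, l)\<in>{1..R} \<times> {1..L}. 1 - P j l)"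
proof -
  let ?I = "{1..R} \<times> {1..L}"
  define N where "N = (\<lambda>i :: nat \<times> nat. discover_space m v S (num_buckets m p v (snd i)))"
  define H where "H = (\<lambda>i. {\<omega> \<in> space (N i). j \<in> run m (discover m v spot (num_buckets m p v (snd i)) \<omega>) x})"
  have N: "prob_space (N i)" for i
    unfolding N_def by (rule prob_space_discover_space[OF fam])
  interpret finite_product_prob_space N ?I
  proof (intro finite_product_prob_space.intro product_prob_space.intro
      product_sigma_finite.intro finite_product_sigma_finite.intro
      finite_product_sigma_finite_axioms.intro product_prob_space_axioms.intro)
  qed (use N in \<open>auto intro: prob_space_imp_sigma_finite\<close>)
  have space: "multi_space m p v S L R = PiM ?I N"
    by (simp add: multi_space_def N_def case_prod_beta')
  have H: "H i \<in> sets (N i)" for i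
    unfolding H_def N_def by (rule sets_discover[OF fam])
  have eq: "Miss j = Pi\<^sub>E ?I (\<lambda>i. space (N i) - H i)"
  proof -
    have "j \<in> candidates m p v spot L R \<omega> x \<longleftrightarrow> (\<exists>i\<in>?I. \<omega> i \<in> H i)" if "\<omega> \<in> Pi\<^sub>E ?I (\<lambda>i. space (N i))" for \<omega>
      unfolding candidates_def H_def case_prod_beta prod.collapse using PiE_mem[OF that] by blast
    then have "Miss j = {\<omega> \<in> Pi\<^sub>E ?I (\<lambda>i. space (N i)). \<forall>i\<in>?I. \<omega> i \<notin> H i}"
      unfolding Miss_def space space_PiM by blast
    also have "\<dots> = Pi\<^sub>E ?I (\<lambda>i. space (N i) - H i)"
      unfolding PiE_iff by (simp add: PiE_iff set_eq_iff) blast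
    finally show ?thesis .
  qed
  show "Miss j \<in> sets (multi_space m p v S L R)"
    unfolding eq space using H by (intro sets_PiM_I_finite) auto
  have "measure (multi_space m p v S L R) (Miss j) = (\<Prod>i\<in>?I. measure (N i) (space (N i) - H i))"
    unfolding eq space using H by (intro prob_times) auto
  also have "\<dots> = (\<Prod>i\<in>?I. 1 - measure (N i) (H i))"
    using prob_space.prob_compl[OF N H] by simp
  also have "\<dots> = (\<Prod>(r, l)\<in>?I. 1 - P j l)"
    by (simp add: N_def H_def P_def case_prod_beta')
  finally show "measure (multi_space m p v S L R) (Miss j) = (\<Prod>(r, l)\<in>?I. 1 - P j l)" .
qed

lemma prob_space_multi_space:
  assumes "is_spot_family m S spot"
  shows "prob_space (multi_space m p v S L R)"
  unfolding multi_space_def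
  by (intro prob_space_PiM) (auto intro: prob_space_discover_space[OF assms] split: prod.split)

text \<open>
  A coordinate contributes \<open>\<bar>x j\<bar> powr q\<close> to the error if it is missed and nothing otherwise, so the
  expected error is a weighted sum of miss probabilities.
\<close>

lemma multi_alg_error:
  fixes p q :: real and x :: "nat \<Rightarrow> real" and v :: version and L R :: nat
  assumes p: "1 \<le> p" and pq: "p < q" and m: "m \<ge> 1" and fam: "is_spot_family m S spot"
    and R: "(q - p) / min 2 p \<le> real R" and x: "lp_norm p {1..m} x \<le> 1"
  defines "err \<equiv> \<lambda>\<omega>. lp_norm q {1..m} (\<lambda>j. x j - run m (multi_alg m p v spot L R \<omega>) x j) powr q"
  shows "integrable (multi_space m p v S L R) err"
    and "(\<integral>\<omega>. err \<omega> \<partial>multi_space m p v S L R) \<le> 2 powr (- ((q - p) / min 2 p) * real L)"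
proof -
  let ?\<Omega> = "multi_space m p v S L R"
  let ?t = "min 2 p"
  interpret prob_space ?\<Omega> by (rule prob_space_multi_space[OF fam])
  define Miss where "Miss = (\<lambda>j. {\<omega> \<in> space ?\<Omega>. j \<notin> candidates m p v spot L R \<omega> x})"
  define P where "P = (\<lambda>j l. measure (discover_space m v S (num_buckets m p v l))
    {\<omega> \<in> space (discover_space m v S (num_buckets m p v l)).
      j \<in> run m (discover m v spot (num_buckets m p v l) \<omega>) x})"
  define f where "f = (\<lambda>\<omega>. \<Sum>j=1..m. \<bar>x j\<bar> powr q * indicator (Miss j) \<omega>)"
  have Miss: "Miss j \<in> events" for j
    unfolding Miss_def by (rule multi_miss[OF fam])
  have probMiss: "prob (Miss j) = (\<Prod>(r, l)\<in>{1..R} \<times> {1..L}. 1 - P j l)" for j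
    unfolding Miss_def P_def by (rule multi_miss[OF fam])
  have err: "err \<omega> = f \<omega>" if \<omega>: "\<omega> \<in> space ?\<Omega>" for \<omega>
  proof -
    let ?z = "run m (multi_alg m p v spot L R \<omega>) x"
    have "err \<omega> = (\<Sum>j=1..m. \<bar>x j - ?z j\<bar> powr q)"
      using p pq unfolding err_def lp_norm_def by (simp add: powr_powr sum_nonneg)
    also have "\<dots> = f \<omega>"
      unfolding f_def
    proof (intro sum.cong refl)
      fix j assume j: "j \<in> {1..m}"
      show "\<bar>x j - ?z j\<bar> powr q = \<bar>x j\<bar> powr q * indicator (Miss j) \<omega>"
        using run_multi_alg[OF fam \<omega> j, of x] \<omega> p pq by (simp add: Miss_def indicator_def)
    qed
    finally show ?thesis .
  qed
  have int: "integrable ?\<Omega> (\<lambda>\<omega>. \<bar>x j\<bar> powr q * indicator (Miss j) \<omega>)" for j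
    using Miss by (intro integrable_mult_right integrable_real_indicator) (auto simp: less_top[symmetric])
  then have "integrable ?\<Omega> f"
    unfolding f_def by (intro Bochner_Integration.integrable_sum)
  then show "integrable ?\<Omega> err"
    by (subst Bochner_Integration.integrable_cong[OF refl, of ?\<Omega> err f]) (simp_all add: err)
  have sum: "(\<Sum>j=1..m. \<bar>x j\<bar> powr p) \<le> 1"
  proof (rule ccontr)
    assume "\<not> ?thesis"
    then have "1 < (\<Sum>j=1..m. \<bar>x j\<bar> powr p) powr (1 / p)" using p by (intro gr_one_powr) auto
    then show False using x by (simp add: lp_norm_def)
  qed
  have "(\<integral>\<omega>. err \<omega> \<partial>?\<Omega>) = expectation f"
    by (rule Bochner_Integration.integral_cong[OF refl err])
  also have "\<dots> = (\<Sum>j=1..m. \<bar>x j\<bar> powr q * prob (Miss j))"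
  proof -
    have "Miss j \<inter> space ?\<Omega> = Miss j" for j by (auto simp: Miss_def)
    then show ?thesis
      unfolding f_def using int by (subst Bochner_Integration.integral_sum) simp_all
  qed
  also have "\<dots> \<le> (\<Sum>j=1..m. \<bar>x j\<bar> powr p * 2 powr (- ((q - p) / ?t) * real L))"
  proof (rule sum_mono)
    fix j assume j: "j \<in> {1..m}"
    have "\<bar>x j\<bar> powr p \<le> (\<Sum>j=1..m. \<bar>x j\<bar> powr p)"
      using j by (intro member_le_sum) auto
    then have "\<bar>x j\<bar> powr p \<le> 1" using sum by linarith
    then have "\<bar>x j\<bar> \<le> 1"
      using p gr_one_powr[of "\<bar>x j\<bar>" p] by linarith
    moreover have "0 \<le> P j l" "P j l \<le> 1" for l
      unfolding P_def using prob_space.prob_le_1[OF prob_space_discover_space(1)[OF fam]] by auto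
    moreover have "1 / 2 \<le> P j l" if "1 \<le> 2 ^ l * \<bar>x j\<bar> powr ?t" for l
      unfolding P_def using p that by (intro level_detects[OF fam _ j sum]) auto
    ultimately show "\<bar>x j\<bar> powr q * prob (Miss j) \<le> \<bar>x j\<bar> powr p * 2 powr (- ((q - p) / ?t) * real L)"
      unfolding probMiss using p pq R by (intro coordinate_error_le) auto
  qed
  also have "\<dots> \<le> 1 * 2 powr (- ((q - p) / ?t) * real L)"
    unfolding sum_distrib_right[symmetric] using sum by (intro mult_right_mono) auto
  finally show "(\<integral>\<omega>. err \<omega> \<partial>?\<Omega>) \<le> 2 powr (- ((q - p) / ?t) * real L)" by simp
qed

section \<open>Information cost\<close>

text \<open>
  Per bucket there are at most 551 queries for the preconditioner, \<open>2 (k_star m D + 1)\<close> for Spot, and one for the final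
  direct measurement, as each bucket yields at most one candidate.
\<close>

lemma multi_alg_num_queries:
  assumes fam: "is_spot_family m S spot" and \<omega>: "\<omega> \<in> space (multi_space m p v S L R)"
  shows "num_queries m (multi_alg m p v spot L R \<omega>) x
    \<le> R * (\<Sum>l=1..L. num_buckets m p v l * (554 + 2 * k_star m (num_buckets m p v l)))"
proof -
  let ?D = "num_buckets m p v"
  let ?A = "\<lambda>i. discover m v spot (?D (snd i)) (\<omega> i)"
  let ?I = "{1..R} \<times> {1..L}"
  let ?K = "candidates m p v spot L R \<omega> x"
  have A: "card (run m (?A i) x) \<le> ?D (snd i)"
    "num_queries m (?A i) x \<le> ?D (snd i) * (551 + 2 * (k_star m (?D (snd i)) + 1))" if "i \<in> ?I" for i
  proof -
    have "\<omega> i \<in> space (discover_space m v S (?D (snd i)))"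
      using space_multi_space[OF \<omega>, of "fst i" "snd i"] that by auto
    then show "card (run m (?A i) x) \<le> ?D (snd i)"
      "num_queries m (?A i) x \<le> ?D (snd i) * (551 + 2 * (k_star m (?D (snd i)) + 1))"
      by (rule discover_bounds[OF fam])+
  qed
  have "?K = (\<Union>i\<in>?I. run m (?A i) x)"
    by (simp only: candidates_def case_prod_beta' prod.collapse)
  then have "card ?K \<le> (\<Sum>i\<in>?I. card (run m (?A i) x))"
    by (simp add: card_UN_le)
  also have "\<dots> \<le> (\<Sum>i\<in>?I. ?D (snd i))"
    by (intro sum_mono A)
  finally have card: "card ?K \<le> (\<Sum>i\<in>?I. ?D (snd i))" .
  have "num_queries m (multi_alg m p v spot L R \<omega>) x = (\<Sum>i\<in>?I. num_queries m (?A i) x) + card ?K"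
  proof -
    have "set (List.product [1..<Suc R] [1..<Suc L]) = ?I"
      by (auto simp del: upt_Suc)
    moreover have "distinct (List.product [1..<Suc R] [1..<Suc L])"
      by (intro distinct_product distinct_upt)
    ultimately have "(\<Sum>i\<leftarrow>List.product [1..<Suc R] [1..<Suc L]. num_queries m (?A i) x) = (\<Sum>i\<in>?I. num_queries m (?A i) x)"
      by (simp only: sum_list_distinct_conv_sum_set)
    then show ?thesis
      unfolding multi_alg_def num_queries_then_alg run_candidates_alg
      unfolding num_queries_union_alg case_prod_beta'
      by (simp del: upt_Suc)
  qed
  also have "\<dots> \<le> (\<Sum>i\<in>?I. ?D (snd i) * (551 + 2 * (k_star m (?D (snd i)) + 1))) + (\<Sum>i\<in>?I. ?D (snd i))"
    by (intro add_mono sum_mono A card)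
  also have "\<dots> = (\<Sum>i\<in>?I. ?D (snd i) * (554 + 2 * k_star m (?D (snd i))))"
    unfolding sum.distrib[symmetric] by (intro sum.cong refl) (simp add: algebra_simps)
  also have "\<dots> = (\<Sum>r=1..R. \<Sum>l=1..L. ?D l * (554 + 2 * k_star m (?D l)))"
    by (simp only: sum.cartesian_product case_prod_beta')
  finally show ?thesis by simp
qed

lemma num_buckets_eq:
  assumes "p > 0" "m \<ge> 1"
  shows "num_buckets m p v l = nat \<lceil>C_const v (min 2 p) * real m powr (1 - min 2 p / p) * 2 ^ l\<rceil>"
  using assms by (auto simp: num_buckets_def min_def)

text \<open>
  In the application \<open>i\<close> is \<open>L - l\<close>. The bucket size is at most \<open>U * 2 ^ i\<close>, whose binary logarithm is \<open>log 2 U + i\<close>.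
  Since \<open>log 2 U \<ge> 4\<close>, a quarter of this is at most \<open>ln U * (1 + i)\<close>, and another logarithm
  separates the factors. The factor 4 in the last assumption leaves room for rounding the bucket
  size up.
\<close>

lemma k_star_le:
  assumes D: "D \<ge> 1" "m \<ge> 1" and U: "U \<ge> 16" and mD: "4 * real m \<le> real D * (U * 2 ^ i)"
  shows "real (k_star m D) \<le> 1 + (ln (ln U) + real i) / ln (9/8)"
proof -
  let ?n = "\<lceil>real m / real D\<rceil>"
  have c: "ln (9/8 :: real) > 0" by simp
  \<comment> \<open>\<open>ln 16 \<ge> 2\<close> keeps the iterated logarithm nonnegative.\<close>
  have "4 * (2 / 3) \<le> 4 * ln (2 :: real)" using ln2_ge_two_thirds by simp
  also have "\<dots> = ln (16 :: real)" using ln_realpow[of "2 :: real" 4] by simp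
  also have "\<dots> \<le> ln U" using U by simp
  finally have lnU: "ln U \<ge> 2" by simp
  then have Y: "ln (ln U) \<ge> 0" by simp
  show ?thesis
  proof (cases "?n = 1")
    case True
    then show ?thesis using c Y by (simp add: k_star_def)
  next
    case False
    have "0 < real m / real D" using D by simp
    with False have n: "?n \<ge> 2" by linarith
    have "16 * 1 \<le> U * 2 ^ i"
      using U by (intro mult_mono) auto
    then have U2: "16 \<le> U * 2 ^ i" by simp
    have "of_int ?n \<le> real m / real D + 1" by linarith
    also have "real m / real D \<le> U * 2 ^ i / 4"
      using mD D by (simp add: field_simps)
    finally have nU: "of_int ?n \<le> U * 2 ^ i" using U2 by linarith
    let ?t = "log 2 (of_int ?n) / 4"
    have t: "?t > 0" using n by simp
    have "log 2 (of_int ?n) \<le> log 2 (U * 2 ^ i)"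
      using nU n U by (subst log_le_cancel_iff) auto
    also have "\<dots> = log 2 U + real i"
      using U by (simp add: log_mult log_nat_power)
    finally have "?t \<le> (log 2 U + real i) / 4" by simp
    also have "\<dots> \<le> log 2 U / 4 * (1 + real i)"
    proof -
      have "log 2 16 \<le> log 2 U" using U by (subst log_le_cancel_iff) auto
      moreover have "log 2 16 = (4 :: real)" using log_nat_power[of "2 :: real" 2 4] by simp
      ultimately have "4 * real i \<le> log 2 U * real i" by (intro mult_right_mono) auto
      then show ?thesis by (simp add: algebra_simps)
    qed
    also have "\<dots> \<le> ln U * (1 + real i)"
    proof (rule mult_right_mono)
      have "ln U / (4 * ln 2) \<le> ln U / 1"
        using lnU ln2_ge_two_thirds by (intro divide_left_mono) auto
      then show "log 2 U / 4 \<le> ln U" by (simp add: log_def mult.commute)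
    qed simp
    finally have "ln ?t \<le> ln (ln U * (1 + real i))"
      using t by (intro ln_mono) auto
    also have "\<dots> = ln (ln U) + ln (1 + real i)"
      using lnU by (subst ln_mult_pos) auto
    also have "\<dots> \<le> ln (ln U) + real i"
      by (simp add: ln_add_one_self_le_self)
    finally have "log (9/8) ?t \<le> (ln (ln U) + real i) / ln (9/8)"
      using c by (simp add: log_def divide_right_mono)
    moreover have "0 \<le> (ln (ln U) + real i) / ln (9/8)"
      using c Y by simp
    moreover have "k_star m D = nat (max 0 \<lceil>log (9/8) ?t\<rceil>)"
      using False by (simp add: k_star_def)
    ultimately show ?thesis
      by linarith
  qed
qed

text \<open>
  The exact value is \<open>4 * 2 ^ L - 2 * L - 4\<close>, which is what the induction needs.
\<close>

lemma sum_geometric_weighted: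
  "(\<Sum>l=1..L. 2 ^ l * (1 + real (L - l))) \<le> 4 * 2 ^ L"
proof -
  have "(\<Sum>l=1..L. 2 ^ l * (1 + real (L - l))) = 4 * 2 ^ L - 2 * real L - 4"
  proof (induction L)
    case (Suc L)
    have "(\<Sum>l=1..L. 2 ^ l * (1 + real (Suc L - l))) = (\<Sum>l=1..L. 2 ^ l * (1 + real (L - l)) + 2 ^ l)"
      by (intro sum.cong refl) (auto simp: Suc_diff_le algebra_simps)
    also have "\<dots> = 4 * 2 ^ L - 2 * real L - 4 + (\<Sum>l=1..L. 2 ^ l)"
      unfolding sum.distrib Suc.IH by simp
    also have "(\<Sum>l=1..L. 2 ^ l) = (2 ^ Suc L - 2 :: real)"
      by (induction L) auto
    finally show ?case by simp
  qed simp
  then show ?thesis by simp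
qed

definition cost_constant :: "real \<Rightarrow> nat \<Rightarrow> real" where
  "cost_constant t R = 4 * real R * (C_const Basic t + C_const Preconditioned t + 1) * (1112 + 4 / ln (9/8))"

text \<open>
  As \<open>ln (ln U) \<ge> 1/2\<close>, the constant cost per bucket and the growth of the iteration depth with \<open>L - l\<close> are both
  absorbed into a multiple of \<open>ln (ln U) * (1 + (L - l))\<close>; the weighted geometric sum does the rest.
\<close>

lemma multi_alg_cost:
  assumes p: "p \<ge> 1" and m: "m \<ge> 1" and fam: "is_spot_family m S spot"
    and big: "16 * 2 ^ L \<le> real m powr (min 2 p / p)" and \<omega>: "\<omega> \<in> space (multi_space m p v S L R)"
  shows "real (num_queries m (multi_alg m p v spot L R \<omega>) x) \<le>
    cost_constant (min 2 p) R * (real m powr (1 - min 2 p / p) * 2 ^ L * ln (ln (real m powr (min 2 p / p) / 2 ^ L)))"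
proof -
  let ?t = "min 2 p"
  let ?D = "num_buckets m p v"
  define W where "W = real m powr (1 - ?t / p)"
  define N where "N = real m powr (?t / p)"
  define U where "U = N / 2 ^ L"
  define Y where "Y = ln (ln U)"
  define c where "c = ln (9/8 :: real)"
  define B where "B = C_const Basic ?t + C_const Preconditioned ?t + 1"
  let ?K = "1112 + 4 / c"
  have c: "c > 0" by (simp add: c_def)
  have "?t / p \<le> 1" using p by simp
  then have W: "W \<ge> 1" unfolding W_def using m by (intro ge_one_powr_ge_zero) auto
  \<comment> \<open>The numbers of buckets are proportional to \<open>W\<close>, so that the ratio of \<open>m\<close> to them is governed by \<open>N\<close>.\<close>
  have NW: "N * W = real m" using m by (simp add: N_def W_def flip: powr_add)
  have U: "U \<ge> 16" using big by (simp add: U_def N_def field_simps)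
  have Y: "Y \<ge> 1 / 2"
  proof -
    have "2 \<le> 4 * ln (2 :: real)" using ln2_ge_two_thirds by simp
    also have "\<dots> = ln (16 :: real)" using ln_realpow[of "2 :: real" 4] by simp
    also have "\<dots> \<le> ln U" using U by simp
    finally have "ln 2 \<le> Y" unfolding Y_def by (intro ln_mono) auto
    then show ?thesis using ln2_ge_two_thirds by linarith
  qed
  have C4: "C_const w ?t \<ge> 4" for w using p by (intro C_const_ge) auto
  have CB: "C_const v ?t + 1 \<le> B"
    unfolding B_def using C4[of Basic] C4[of Preconditioned] by (cases v) auto
  have B: "B \<ge> 0" using CB C4[of v] by linarith
  have level: "real (?D l * (554 + 2 * k_star m (?D l))) \<le> B * W * Y * ?K * (2 ^ l * (1 + real (L - l)))"
    if l: "l \<in> {1..L}" for l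
  proof -
    have "?D l = nat \<lceil>C_const v ?t * W * 2 ^ l\<rceil>"
      unfolding W_def using p m by (intro num_buckets_eq) auto
    then have "real (?D l) \<le> C_const v ?t * W * 2 ^ l + 1"
      using C4[of v] W by (simp add: of_nat_nat ceiling_correct less_imp_le)
    also have "\<dots> \<le> C_const v ?t * W * 2 ^ l + W * 2 ^ l"
    proof -
      have "1 * 1 \<le> W * 2 ^ l" using W by (intro mult_mono) auto
      then show ?thesis by simp
    qed
    also have "\<dots> = (C_const v ?t + 1) * (W * 2 ^ l)" by (simp add: algebra_simps)
    also have "\<dots> \<le> B * (W * 2 ^ l)"
      using CB W by (intro mult_right_mono) auto
    finally have D: "real (?D l) \<le> B * (W * 2 ^ l)" .
    have "4 * real m = 4 * W * (U * 2 ^ L)"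
      using NW by (simp add: U_def mult.commute)
    also have "(2 :: real) ^ L = 2 ^ l * 2 ^ (L - l)"
      using l by (simp flip: power_add)
    also have "4 * W * (U * (2 ^ l * 2 ^ (L - l))) = 4 * W * 2 ^ l * (U * 2 ^ (L - l))"
      by simp
    also have "\<dots> \<le> real (?D l) * (U * 2 ^ (L - l))"
    proof (rule mult_right_mono)
      have "4 * W * 2 ^ l \<le> C_const v ?t * W * 2 ^ l"
        using C4[of v] W by (intro mult_right_mono) auto
      also have "\<dots> \<le> real (?D l)"
        unfolding W_def using p m by (intro num_buckets_ge) auto
      finally show "4 * W * 2 ^ l \<le> real (?D l)" .
    qed (use U in simp)
    finally have "real (k_star m (?D l)) \<le> 1 + (Y + real (L - l)) / c"
      unfolding Y_def c_def using num_buckets_pos[OF _ m, of p v l] p m U by (intro k_star_le) auto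
    then have "554 + 2 * real (k_star m (?D l)) \<le> 556 + 2 / c * (Y + real (L - l))"
      by (simp add: add_divide_distrib)
    also have "\<dots> \<le> Y * ?K * (1 + real (L - l))"
    proof -
      have "556 \<le> 1112 * Y" using Y by simp
      moreover have "1112 * Y \<le> 1112 * Y * (1 + real (L - l))" using Y by simp
      moreover have "2 / c * (Y + real (L - l)) \<le> 2 / c * (2 * Y * (1 + real (L - l)))"
      proof (rule mult_left_mono)
        have "1 * real (L - l) \<le> 2 * Y * real (L - l)" using Y by (intro mult_right_mono) auto
        then show "Y + real (L - l) \<le> 2 * Y * (1 + real (L - l))" using Y by (simp add: algebra_simps)
      qed (use c in simp)
      moreover have "1112 * Y * (1 + real (L - l)) + 2 / c * (2 * Y * (1 + real (L - l))) = Y * ?K * (1 + real (L - l))"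
        by (simp add: algebra_simps add_divide_distrib)
      ultimately show ?thesis by linarith
    qed
    finally have k: "554 + 2 * real (k_star m (?D l)) \<le> Y * ?K * (1 + real (L - l))" .
    have "real (?D l * (554 + 2 * k_star m (?D l))) = real (?D l) * (554 + 2 * real (k_star m (?D l)))"
      by simp
    also have "\<dots> \<le> B * (W * 2 ^ l) * (Y * ?K * (1 + real (L - l)))"
      using B W by (intro mult_mono D k) auto
    finally show ?thesis by (simp add: mult_ac)
  qed
  have pos: "0 \<le> B * W * Y * ?K" using B W Y c by simp
  have "real (num_queries m (multi_alg m p v spot L R \<omega>) x) \<le>
      real (R * (\<Sum>l=1..L. ?D l * (554 + 2 * k_star m (?D l))))"
    using multi_alg_num_queries[OF fam \<omega>] by (simp only: of_nat_le_iff)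
  also have "\<dots> = real R * (\<Sum>l=1..L. real (?D l * (554 + 2 * k_star m (?D l))))"
    by simp
  also have "\<dots> \<le> real R * (\<Sum>l=1..L. B * W * Y * ?K * (2 ^ l * (1 + real (L - l))))"
    by (intro mult_left_mono sum_mono level) auto
  also have "\<dots> = real R * (B * W * Y * ?K * (\<Sum>l=1..L. 2 ^ l * (1 + real (L - l))))"
    by (simp only: sum_distrib_left)
  also have "\<dots> \<le> real R * (B * W * Y * ?K * (4 * 2 ^ L))"
    using pos by (intro mult_left_mono sum_geometric_weighted) auto
  also have "\<dots> = cost_constant ?t R * (W * 2 ^ L * Y)"
    by (simp add: cost_constant_def B_def c_def)
  finally show ?thesis by (simp only: W_def Y_def U_def N_def)
qed

lemma info_cost_le:
  assumes "\<And>\<omega> x. \<omega> \<in> space \<Omega> \<Longrightarrow> real (num_queries m (A \<omega>) x) \<le> c" and c: "0 \<le> c"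
  shows "ereal_of_enat (info_cost m \<Omega> A) \<le> ereal c"
proof -
  have "info_cost m \<Omega> A \<le> enat (nat \<lfloor>c\<rfloor>)"
    unfolding info_cost_def using assms(1) by (intro SUP_least) (auto simp: le_nat_floor)
  then have "ereal_of_enat (info_cost m \<Omega> A) \<le> ereal_of_enat (enat (nat \<lfloor>c\<rfloor>))"
    by (simp only: ereal_of_enat_le_iff)
  also have "\<dots> \<le> ereal c" using c by simp
  finally show ?thesis .
qed

section \<open>Error and cost\<close>

theorem theorem3p1:
  fixes p q :: real
  assumes "1 \<le> p" and "p < q"
  defines "R \<equiv> nat \<lceil>q / min 2 p\<rceil>"
  shows
    "(\<forall>(v :: version) (m :: nat) (L :: nat) (S :: real \<Rightarrow> nat \<Rightarrow> 'w measure) spot.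
        m \<ge> 1 \<and> is_spot_family m S spot \<longrightarrow>
        (\<forall>x :: nat \<Rightarrow> real. lp_norm p {1..m} x \<le> 1 \<longrightarrow>
          (let \<Omega> = multi_space m p v S L R;
               err = (\<lambda>\<omega>. lp_norm q {1..m} (\<lambda>j. x j - run m (multi_alg m p v spot L R \<omega>) x j) powr q)
           in integrable \<Omega> err \<and>
              (\<integral>\<omega>. err \<omega> \<partial>\<Omega>) powr (1 / q)
                \<le> 3 powr (1 / q) *
                  (if p \<le> 2 then 2 powr (- (1 / p - 1 / q) * real L)
                   else 2 powr (- (1 / 2) * (1 - p / q) * real L))))) \<and>
     (\<exists>C > 0.
        \<forall>(v :: version) (m :: nat) (L :: nat) (S :: real \<Rightarrow> nat \<Rightarrow> 'w measure) spot.
          m \<ge> 1 \<and> is_spot_family m S spot \<and> real m powr (min 1 (2 / p)) \<ge> 16 * 2 ^ L \<longrightarrow>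
          ereal_of_enat (info_cost m (multi_space m p v S L R) (multi_alg m p v spot L R))
            \<le> ereal (C * (if p \<le> 2 then 2 ^ L * ln (ln (real m / 2 ^ L))
                          else real m powr (1 - 2 / p) * 2 ^ L
                                 * ln (ln (real m powr (2 / p) / 2 ^ L)))))"
proof (intro conjI allI impI)
  let ?t = "min 2 p"
  have t: "?t > 0" using assms(1) by simp
  fix v :: version and m L :: nat and S :: "real \<Rightarrow> nat \<Rightarrow> 'w measure" and spot and x :: "nat \<Rightarrow> real"
  assume "m \<ge> 1 \<and> is_spot_family m S spot" and x: "lp_norm p {1..m} x \<le> 1"
  then have m: "m \<ge> 1" and fam: "is_spot_family m S spot" by auto
  let ?\<Omega> = "multi_space m p v S L R"
  let ?err = "\<lambda>\<omega>. lp_norm q {1..m} (\<lambda>j. x j - run m (multi_alg m p v spot L R \<omega>) x j) powr q"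
  have "(q - p) / ?t \<le> q / ?t" using t assms(1) by (intro divide_right_mono) auto
  also have "\<dots> \<le> real R" unfolding R_def by (rule real_nat_ceiling_ge)
  finally have R: "(q - p) / ?t \<le> real R" .
  note error = multi_alg_error[OF assms(1,2) m fam R x, of v L]
  have "(\<integral>\<omega>. ?err \<omega> \<partial>?\<Omega>) powr (1 / q) \<le> (2 powr (- ((q - p) / ?t) * real L)) powr (1 / q)"
    using error(2) assms by (intro powr_mono2) (auto intro!: integral_nonneg_AE)
  also have "\<dots> = (if p \<le> 2 then 2 powr (- (1 / p - 1 / q) * real L)
      else 2 powr (- (1 / 2) * (1 - p / q) * real L))" (is "_ = ?rate")
    using assms by (auto simp: powr_powr min_def field_simps)
  \<comment> \<open>The rate already holds with the constant 1.\<close>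
  also have "\<dots> \<le> 3 powr (1 / q) * ?rate"
  proof -
    have "1 \<le> (3 :: real) powr (1 / q)" using assms by (intro ge_one_powr_ge_zero) auto
    from mult_right_mono[OF this, of ?rate] show ?thesis by simp
  qed
  finally show "let \<Omega> = multi_space m p v S L R;
               err = (\<lambda>\<omega>. lp_norm q {1..m} (\<lambda>j. x j - run m (multi_alg m p v spot L R \<omega>) x j) powr q)
           in integrable \<Omega> err \<and> (\<integral>\<omega>. err \<omega> \<partial>\<Omega>) powr (1 / q) \<le> 3 powr (1 / q) * ?rate"
    unfolding Let_def using error(1) by blast
next
  let ?t = "min 2 p"
  let ?C = "cost_constant ?t R"
  have "0 < q / ?t" using assms by simp
  then have "R \<ge> 1" unfolding R_def by linarith
  then have C: "?C > 0"
    using C_const_ge[of ?t Basic] C_const_ge[of ?t Preconditioned] assms(1)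
    unfolding cost_constant_def by (intro mult_pos_pos add_pos_pos) auto
  have frac: "min 1 (2 / p) = ?t / p" using assms(1) by (simp add: min_def)
  show "\<exists>C>0. \<forall>(v :: version) (m :: nat) (L :: nat) (S :: real \<Rightarrow> nat \<Rightarrow> 'w measure) spot.
          m \<ge> 1 \<and> is_spot_family m S spot \<and> real m powr (min 1 (2 / p)) \<ge> 16 * 2 ^ L \<longrightarrow>
          ereal_of_enat (info_cost m (multi_space m p v S L R) (multi_alg m p v spot L R))
            \<le> ereal (C * (if p \<le> 2 then 2 ^ L * ln (ln (real m / 2 ^ L))
                          else real m powr (1 - 2 / p) * 2 ^ L
                                 * ln (ln (real m powr (2 / p) / 2 ^ L))))"
  proof (intro exI[of _ ?C] conjI C allI impI)
    fix v :: version and m L :: nat and S :: "real \<Rightarrow> nat \<Rightarrow> 'w measure" and spot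
    assume *: "m \<ge> 1 \<and> is_spot_family m S spot \<and> real m powr (min 1 (2 / p)) \<ge> 16 * 2 ^ L"
    then have m: "m \<ge> 1" and fam: "is_spot_family m S spot" and big: "16 * 2 ^ L \<le> real m powr (?t / p)"
      by (auto simp: frac)
    have rate: "(if p \<le> 2 then 2 ^ L * ln (ln (real m / 2 ^ L))
        else real m powr (1 - 2 / p) * 2 ^ L * ln (ln (real m powr (2 / p) / 2 ^ L)))
      = real m powr (1 - ?t / p) * 2 ^ L * ln (ln (real m powr (?t / p) / 2 ^ L))" (is "?rate = _")
      using m assms(1) by (auto simp: min_def)
    have cost: "real (num_queries m (multi_alg m p v spot L R \<omega>) x) \<le> ?C * ?rate"
      if "\<omega> \<in> space (multi_space m p v S L R)" for \<omega> x
      unfolding rate by (rule multi_alg_cost[OF assms(1) m fam big that])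
    interpret prob_space "multi_space m p v S L R"
      by (rule prob_space_multi_space[OF fam])
    \<comment> \<open>Any cost is nonnegative, hence so is its bound.\<close>
    obtain \<omega> where "\<omega> \<in> space (multi_space m p v S L R)"
      using not_empty by blast
    from cost[OF this] have "0 \<le> ?C * ?rate"
      using of_nat_0_le_iff order.trans by blast
    with cost show "ereal_of_enat (info_cost m (multi_space m p v S L R) (multi_alg m p v spot L R))
        \<le> ereal (?C * ?rate)"
      by (intro info_cost_le)
  qed
qed

end
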